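(* Let $(G,G')$ be a real reductive dual pair in $\mathbf{Sp}=Sp_{2N}(\mathbb{R})$, with $K$, $\widetilde{K}$, $\mathfrak{g}$ and the Fock model $\mathcal{F}$ as fixed in the context. Let $\pi$ be an irreducible $(\mathfrak{g},\widetilde{K})$-module with a non-zero theta lift. If $\sigma_{1},\sigma_{2}\in\mathcal{R}(\widetilde{K},\pi)$, then $\sigma_{1},\sigma_{2}\in\mathcal{R}(\widetilde{K},\mathcal{F})$ and $\deg(\sigma_{1})\equiv\deg(\sigma_{2})\pmod 2$.
   Context: Lie groups are denoted by upper case Latin letters and their complexified Lie algebras by the corresponding lower case Gothic letters. $K$-types. For a compact Lie group $K$, a $K$-type is an equivalence class of irreducible continuous $K$-modules (automatically finite-dimensional and unitary); $\mathcal{R}(K)$ is the set of $K$-types. For a $(\mathfrak{g},K)$-module (or locally finite $K$-module) $V$, a $K$-type $\sigma$ occurs in $V$ if $\mathrm{Hom}_{K}(\sigma,V)\neq 0$, and $\mathcal{R}(K,V)$ is the set of $K$-types occurring in $V$. Dual pairs. A real reductive dual pair is a pair $(G,G')$ of closed reductive subgroups of $\mathbf{Sp}=Sp_{2N}(\mathbb{R})$ (for some $N$) which are mutual centralizers of each other. For a subgroup $E\subseteq\mathbf{Sp}$, $\widetilde{E}$ is its preimage in the metaplectic group $\widetilde{\mathbf{Sp}}$, the unique non-trivial two-fold central extension of $\mathbf{Sp}$. Let $\mathbf{U}=U(N)$ be a maximal compact subgroup of $\mathbf{Sp}$. It is assumed that $G,G'$ are embedded in $\mathbf{Sp}$ so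 that $K=\mathbf{U}\cap G$ and $K'=\mathbf{U}\cap G'$ are maximal compact subgroups of $G$ and $G'$; then $\widetilde{K},\widetilde{K'}$ are maximal compact in $\widetilde{G},\widetilde{G'}$. Fock model. Let $\omega$ be the Segal-Shale-Weil oscillator representation of $\widetilde{\mathbf{Sp}}$ associated to the character $t\mapsto\exp(2\pi\sqrt{-1}\,t)$ of $\mathbb{R}$. Its $(\mathfrak{sp},\widetilde{\mathbf{U}})$-module is realized by the Fock model on the space $\mathcal{F}=\mathrm{Poly}(\mathbb{C}^{N})$ of complex polynomials on $\mathbb{C}^{N}$. Theta lift (Howe). For an irreducible $(\mathfrak{g},\widetilde{K})$-module $\pi$, $$\mathcal{F}\Big/\bigcap_{T\in\mathrm{Hom}_{\mathfrak{g},\widetilde{K}}(\mathcal{F},\pi)}\mathrm{Ker}(T)\simeq\pi\otimes\Theta(\pi)$$ with $\Theta(\pi)$ a finitely generated admissible $(\mathfrak{g}',\widetilde{K'})$-module. If $\Theta(\pi)\neq0$, it has a unique irreducible $(\mathfrak{g}',\widetilde{K'})$-quotient $\theta(\pi)$, called the theta lift of $\pi$; if $\Theta(\pi)=0$ (equivalently $\mathrm{Hom}_{\mathfrak{g},\widetilde{K}}(\mathcal{F},\pi)=0$), set $\theta(\pi)=0$. Degree. For $\sigma\in\mathcal{R}(\widetilde{K},\mathcal{F})$, $\deg(\sigma)$ (with respect to $(G,G')$) is the minimal degree of nonzero polynomials in the $\sigma$-isotypic subspace $\mathcal{F}_{\sigma}=\sum_{\varphi\in\mathrm{Hom}_{\widetilde{K}}(\sigma,\mathcal{F})}\mathrm{Im}(\varphi)$.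 *)

theory Defs
  imports "HOL-Analysis.Analysis" "HOL-Library.Function_Algebras"
begin

section \<open>The symplectic group\<close>

text \<open>
  The real symplectic space is \<open>\<real>\<^sup>N \<oplus> \<real>\<^sup>N\<close> with \<open>N = CARD('n)\<close>, indexed by \<open>'n + 'n\<close>, with the
  form \<open>\<langle>(x, y), (x', y')\<rangle> = x \<bullet> y' - y \<bullet> x'\<close>.  It is identified with \<open>\<complex>\<^sup>N\<close> by
  \<open>z = x + \<i> y\<close>; then the form is the imaginary part of \<open>\<Sum>j. cnj (z j) * z' j\<close>.
\<close>

type_synonym 'n rmat = "real ^ ('n + 'n) ^ ('n + 'n)"
type_synonym 'n cmat = "complex ^ ('n + 'n) ^ ('n + 'n)"

definition blkA :: "'a ^ ('n + 'n) ^ ('n + 'n) \<Rightarrow> 'a ^ 'n ^ ('n::finite)" where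
  "blkA g = (\<chi> i j. g $ Inl i $ Inl j)"

definition blkB :: "'a ^ ('n + 'n) ^ ('n + 'n) \<Rightarrow> 'a ^ 'n ^ ('n::finite)" where
  "blkB g = (\<chi> i j. g $ Inl i $ Inr j)"

definition blkC :: "'a ^ ('n + 'n) ^ ('n + 'n) \<Rightarrow> 'a ^ 'n ^ ('n::finite)" where
  "blkC g = (\<chi> i j. g $ Inr i $ Inl j)"

definition blkD :: "'a ^ ('n + 'n) ^ ('n + 'n) \<Rightarrow> 'a ^ 'n ^ ('n::finite)" where
  "blkD g = (\<chi> i j. g $ Inr i $ Inr j)"

definition symp_J :: "('n::finite) rmat" where
  "symp_J = (\<chi> p q. case (p, q) of
      (Inl i, Inr j) \<Rightarrow> (if i = j then 1 else 0)
    | (Inr i, Inl j) \<Rightarrow> (if i = j then -1 else 0)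
    | _ \<Rightarrow> 0)"

definition Sp :: "('n::finite) rmat set" where
  "Sp = {g. transpose g ** symp_J ** g = symp_J}"

text \<open>
  The orthogonal elements of \<open>Sp\<close> are those that act \<open>\<complex>\<close>-linearly on \<open>\<complex>\<^sup>N\<close>; they have the block
  form \<open>(a, -c; c, a)\<close> and act by the unitary matrix \<open>a + \<i> c\<close>.
\<close>

definition maxU :: "('n::finite) rmat set" where
  "maxU = {g \<in> Sp. orthogonal_matrix g}"

definition unitary_of :: "('n::finite) rmat \<Rightarrow> complex ^ 'n ^ 'n" where
  "unitary_of u = (\<chi> i j. Complex (blkA u $ i $ j) (blkC u $ i $ j))"

section \<open>Subgroups and dual pairs\<close>

definition subgroup_of_Sp :: "('n::finite) rmat set \<Rightarrow> bool" where
  "subgroup_of_Sp G \<longleftrightarrow> G \<subseteq> Sp \<and> mat 1 \<in> G \<and>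
     (\<forall>g\<in>G. \<forall>h\<in>G. g ** h \<in> G) \<and> (\<forall>g\<in>G. matrix_inv g \<in> G)"

definition centralizer_Sp :: "('n::finite) rmat set \<Rightarrow> 'n rmat set" where
  "centralizer_Sp E = {g \<in> Sp. \<forall>h\<in>E. g ** h = h ** g}"

text \<open>Following Howe, a subgroup of \<open>Sp\<close> is reductive if the symplectic space is a completely
  reducible module for it.\<close>

definition reductive_subgroup :: "('n::finite) rmat set \<Rightarrow> bool" where
  "reductive_subgroup G \<longleftrightarrow> subgroup_of_Sp G \<and>
     (\<forall>W. subspace W \<and> (\<forall>g\<in>G. \<forall>w\<in>W. g *v w \<in> W) \<longrightarrow>
        (\<exists>W'. subspace W' \<and> (\<forall>g\<in>G. \<forall>w\<in>W'. g *v w \<in> W') \<and>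
              W \<inter> W' = {0} \<and> (\<forall>v. \<exists>w\<in>W. \<exists>w'\<in>W'. v = w + w')))"

definition reductive_dual_pair :: "('n::finite) rmat set \<Rightarrow> 'n rmat set \<Rightarrow> bool" where
  "reductive_dual_pair G G' \<longleftrightarrow>
     closed G \<and> closed G' \<and> reductive_subgroup G \<and> reductive_subgroup G' \<and>
     G' = centralizer_Sp G \<and> G = centralizer_Sp G'"

definition maximal_compact_in :: "('n::finite) rmat set \<Rightarrow> 'n rmat set \<Rightarrow> bool" where
  "maximal_compact_in K G \<longleftrightarrow> subgroup_of_Sp K \<and> compact K \<and> K \<subseteq> G \<and>
     (\<forall>L. subgroup_of_Sp L \<and> compact L \<and> K \<subseteq> L \<and> L \<subseteq> G \<longrightarrow> L = K)"

section \<open>Lie algebras\<close>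

primrec matrix_pow :: "'a::semiring_1 ^ 'm ^ 'm \<Rightarrow> nat \<Rightarrow> 'a ^ 'm ^ ('m::finite)" where
  "matrix_pow X 0 = mat 1"
| "matrix_pow X (Suc k) = X ** matrix_pow X k"

text \<open>The type class function \<open>exp\<close> is not the matrix exponential, because multiplication on
  type \<open>vec\<close> is componentwise.\<close>

definition matrix_exp :: "real ^ 'm ^ 'm \<Rightarrow> real ^ 'm ^ ('m::finite)" where
  "matrix_exp X = (\<Sum>k. (1 / fact k) *\<^sub>R matrix_pow X k)"

definition real_Lie :: "('n::finite) rmat set \<Rightarrow> 'n rmat set" where
  "real_Lie G = {X. \<forall>t::real. matrix_exp (t *\<^sub>R X) \<in> G}"

definition complex_Lie :: "('n::finite) rmat set \<Rightarrow> 'n cmat set" where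
  "complex_Lie G =
     {(\<chi> i j. Complex (X $ i $ j) (Y $ i $ j)) | X Y. X \<in> real_Lie G \<and> Y \<in> real_Lie G}"

definition complexify :: "('n::finite) rmat \<Rightarrow> 'n cmat" where
  "complexify X = map_matrix complex_of_real X"

section \<open>The metaplectic group\<close>

definition siegel :: "(complex ^ 'n ^ ('n::finite)) set" where
  "siegel = {Z. transpose Z = Z \<and>
     (\<forall>x::real^'n. x \<noteq> 0 \<longrightarrow> 0 < (\<Sum>i\<in>UNIV. \<Sum>j\<in>UNIV. Im (Z $ i $ j) * x $ i * x $ j))}"

definition aut_factor :: "('n::finite) rmat \<Rightarrow> complex ^ 'n ^ 'n \<Rightarrow> complex ^ 'n ^ 'n" where
  "aut_factor g Z = blkC (complexify g) ** Z + blkD (complexify g)"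

definition siegel_act :: "('n::finite) rmat \<Rightarrow> complex ^ 'n ^ 'n \<Rightarrow> complex ^ 'n ^ 'n" where
  "siegel_act g Z =
     (blkA (complexify g) ** Z + blkB (complexify g)) ** matrix_inv (aut_factor g Z)"

text \<open>
  The non-trivial two-fold central extension of \<open>Sp\<close>: its elements are the elements \<open>g\<close> of \<open>Sp\<close>
  together with a continuous (hence holomorphic) branch of the square root of \<open>det (c Z + d)\<close> on
  the Siegel upper half space.  The branch is extended by \<open>0\<close> outside so that it is determined
  by its values on the half space.  The topology is that of the product type, i.e. pointwise
  convergence in the second component.
\<close>

type_synonym 'n mp = "'n rmat \<times> (complex ^ 'n ^ 'n \<Rightarrow> complex)"

definition Mp :: "('n::finite) mp set" where
  "Mp = {(g, \<phi>). g \<in> Sp \<and> continuous_on siegel \<phi> \<and>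
           (\<forall>Z\<in>siegel. (\<phi> Z)\<^sup>2 = det (aut_factor g Z)) \<and> (\<forall>Z. Z \<notin> siegel \<longrightarrow> \<phi> Z = 0)}"

definition mp_one :: "('n::finite) mp" where
  "mp_one = (mat 1, \<lambda>Z. if Z \<in> siegel then 1 else 0)"

definition mp_mult :: "('n::finite) mp \<Rightarrow> 'n mp \<Rightarrow> 'n mp" where
  "mp_mult x y = (fst x ** fst y,
     \<lambda>Z. if Z \<in> siegel then snd x (siegel_act (fst y) Z) * snd y Z else 0)"

definition cover :: "('n::finite) rmat set \<Rightarrow> 'n mp set" where
  "cover E = {x \<in> Mp. fst x \<in> E}"

definition coverK :: "('n::finite) rmat set \<Rightarrow> 'n mp set" where
  "coverK G = cover (maxU \<inter> G)"

section \<open>Modules\<close>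

text \<open>
  The complex vector space underlying a module is a subspace \<open>vecs\<close> of an ambient type, with
  scalar multiplication \<open>scl\<close>.  The action maps matter only on \<open>vecs\<close>, and only for
  elements of the group and Lie algebra in question.
\<close>

record ('k, 'v) kmod =
  vecs :: "'v set"
  scl :: "complex \<Rightarrow> 'v \<Rightarrow> 'v"
  gact :: "'k \<Rightarrow> 'v \<Rightarrow> 'v"

record ('k, 'l, 'v) gkmod = "('k, 'v) kmod" +
  lact :: "'l \<Rightarrow> 'v \<Rightarrow> 'v"

type_synonym ('n, 'v) kmodule = "('n mp, 'v) kmod"
type_synonym ('n, 'v) gkmodule = "('n mp, 'n cmat, 'v) gkmod"

definition linear_on ::
  "('k, 'v::ab_group_add, 'z) kmod_scheme \<Rightarrow> (complex \<Rightarrow> 'w \<Rightarrow> 'w) \<Rightarrow>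
   ('v \<Rightarrow> 'w::ab_group_add) \<Rightarrow> bool" where
  "linear_on M s T \<longleftrightarrow>
     (\<forall>x\<in>vecs M. \<forall>y\<in>vecs M. T (x + y) = T x + T y) \<and>
     (\<forall>c. \<forall>x\<in>vecs M. T (scl M c x) = s c (T x))"

definition functional_on :: "('k, 'v::ab_group_add, 'z) kmod_scheme \<Rightarrow> ('v \<Rightarrow> complex) \<Rightarrow> bool" where
  "functional_on M f \<longleftrightarrow> linear_on M (*) f"

text \<open>
  A locally finite continuous module of a subgroup \<open>K\<close> of \<open>Mp\<close>.  As the span of an orbit is
  finite-dimensional, continuity of the orbit map is continuity of its composites with all linear
  functionals; differentiability is treated in the same way below.
\<close>

definition K_module :: "('n::finite) mp set \<Rightarrow> ('n mp, 'v::ab_group_add, 'z) kmod_scheme \<Rightarrow> bool" where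
  "K_module K M \<longleftrightarrow>
     vector_space (scl M) \<and> module.subspace (scl M) (vecs M) \<and>
     (\<forall>k\<in>K. linear_on M (scl M) (gact M k) \<and> gact M k ` vecs M \<subseteq> vecs M) \<and>
     (\<forall>v\<in>vecs M. gact M mp_one v = v) \<and>
     (\<forall>k\<in>K. \<forall>l\<in>K. \<forall>v\<in>vecs M. gact M (mp_mult k l) v = gact M k (gact M l v)) \<and>
     (\<forall>v\<in>vecs M. \<exists>B. finite B \<and> B \<subseteq> vecs M \<and>
        (\<forall>k\<in>K. gact M k v \<in> module.span (scl M) B)) \<and>
     (\<forall>v\<in>vecs M. \<forall>f. functional_on M f \<longrightarrow> continuous_on K (\<lambda>k. f (gact M k v)))"

text \<open>
  In the last clause \<open>\<gamma>\<close> is the one-parameter subgroup of \<open>coverK G\<close> generated by \<open>X\<close>, the Lie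
  algebras of \<open>coverK G\<close> and of \<open>maxU \<inter> G\<close> being identified via the covering map.
\<close>

definition gK_module :: "('n::finite) rmat set \<Rightarrow> ('n, 'v::ab_group_add) gkmodule \<Rightarrow> bool" where
  "gK_module G M \<longleftrightarrow>
     K_module (coverK G) M \<and>
     (\<forall>X\<in>complex_Lie G. linear_on M (scl M) (lact M X) \<and> lact M X ` vecs M \<subseteq> vecs M) \<and>
     (\<forall>X\<in>complex_Lie G. \<forall>Y\<in>complex_Lie G. \<forall>v\<in>vecs M.
        lact M (X + Y) v = lact M X v + lact M Y v \<and>
        lact M (X ** Y - Y ** X) v = lact M X (lact M Y v) - lact M Y (lact M X v)) \<and>
     (\<forall>X\<in>complex_Lie G. \<forall>c. \<forall>v\<in>vecs M. lact M (map_matrix ((*) c) X) v = scl M c (lact M X v)) \<and>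
     (\<forall>k\<in>coverK G. \<forall>X\<in>complex_Lie G. \<forall>v\<in>vecs M.
        gact M k (lact M X v) =
        lact M (complexify (fst k) ** X ** complexify (matrix_inv (fst k))) (gact M k v)) \<and>
     (\<forall>X\<in>real_Lie (maxU \<inter> G). \<forall>\<gamma> :: real \<Rightarrow> 'n mp.
        continuous_on UNIV \<gamma> \<and> (\<forall>t. \<gamma> t \<in> coverK G \<and> fst (\<gamma> t) = matrix_exp (t *\<^sub>R X)) \<and>
        (\<forall>s t. \<gamma> (s + t) = mp_mult (\<gamma> s) (\<gamma> t)) \<longrightarrow>
        (\<forall>v\<in>vecs M. \<forall>f. functional_on M f \<longrightarrow>
           ((\<lambda>t. f (gact M (\<gamma> t) v)) has_vector_derivative f (lact M (complexify X) v)) (at 0)))"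

definition irreducible_gK_module ::
  "('n::finite) rmat set \<Rightarrow> ('n, 'v::ab_group_add) gkmodule \<Rightarrow> bool" where
  "irreducible_gK_module G M \<longleftrightarrow> gK_module G M \<and> vecs M \<noteq> {0} \<and>
     (\<forall>S. S \<subseteq> vecs M \<and> module.subspace (scl M) S \<and>
        (\<forall>k\<in>coverK G. gact M k ` S \<subseteq> S) \<and> (\<forall>X\<in>complex_Lie G. lact M X ` S \<subseteq> S) \<longrightarrow>
        S = {0} \<or> S = vecs M)"

definition Hom_K :: "('n::finite) mp set \<Rightarrow> ('n mp, 'v::ab_group_add, 'z) kmod_scheme \<Rightarrow>
    ('n mp, 'w::ab_group_add, 'y) kmod_scheme \<Rightarrow> ('v \<Rightarrow> 'w) set" where
  "Hom_K K M N = {T. linear_on M (scl N) T \<and> T ` vecs M \<subseteq> vecs N \<and>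
     (\<forall>k\<in>K. \<forall>v\<in>vecs M. T (gact M k v) = gact N k (T v))}"

definition Hom_gK :: "('n::finite) rmat set \<Rightarrow> ('n, 'v::ab_group_add) gkmodule \<Rightarrow>
    ('n, 'w::ab_group_add) gkmodule \<Rightarrow> ('v \<Rightarrow> 'w) set" where
  "Hom_gK G M N = {T \<in> Hom_K (coverK G) M N.
     \<forall>X\<in>complex_Lie G. \<forall>v\<in>vecs M. T (lact M X v) = lact N X (T v)}"

section \<open>\<open>K\<close>-types\<close>

text \<open>A \<open>K\<close>-type is given by a representative; the notions below depend only on its
  equivalence class.  An irreducible locally finite module is finite-dimensional.\<close>

definition is_Ktype :: "('n::finite) mp set \<Rightarrow> ('n, 's::ab_group_add) kmodule \<Rightarrow> bool" where
  "is_Ktype K \<sigma> \<longleftrightarrow> K_module K \<sigma> \<and> vecs \<sigma> \<noteq> {0} \<and>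
     (\<forall>S. S \<subseteq> vecs \<sigma> \<and> module.subspace (scl \<sigma>) S \<and> (\<forall>k\<in>K. gact \<sigma> k ` S \<subseteq> S) \<longrightarrow>
        S = {0} \<or> S = vecs \<sigma>)"

definition Ktypes_in :: "('n::finite) mp set \<Rightarrow> ('n mp, 'v::ab_group_add, 'z) kmod_scheme \<Rightarrow>
    ('n, 's::ab_group_add) kmodule set" where
  "Ktypes_in K M = {\<sigma>. is_Ktype K \<sigma> \<and> (\<exists>T\<in>Hom_K K \<sigma> M. \<exists>v\<in>vecs \<sigma>. T v \<noteq> 0)}"

definition isotypic :: "('n::finite) mp set \<Rightarrow> ('n mp, 'v::ab_group_add, 'z) kmod_scheme \<Rightarrow>
    ('n, 's::ab_group_add) kmodule \<Rightarrow> 'v set" where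
  "isotypic K M \<sigma> = module.span (scl M) (\<Union>T\<in>Hom_K K \<sigma> M. T ` vecs \<sigma>)"

section \<open>The Fock model\<close>

definition poly_deg_le :: "nat \<Rightarrow> (complex ^ ('n::finite) \<Rightarrow> complex) set" where
  "poly_deg_le d = {p. \<exists>c :: ('n \<Rightarrow> nat) \<Rightarrow> complex. \<forall>z.
     p z = (\<Sum>\<alpha> | (\<Sum>i\<in>UNIV. \<alpha> i) \<le> d. c \<alpha> * (\<Prod>i\<in>UNIV. (z $ i) ^ \<alpha> i))}"

definition poly_degree :: "(complex ^ ('n::finite) \<Rightarrow> complex) \<Rightarrow> nat" where
  "poly_degree p = (LEAST d. p \<in> poly_deg_le d)"

definition partial_deriv ::
  "('n::finite) \<Rightarrow> (complex ^ 'n \<Rightarrow> complex) \<Rightarrow> complex ^ 'n \<Rightarrow> complex" where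
  "partial_deriv j p z = deriv (\<lambda>t. p (z + axis j t)) 0"

text \<open>
  A real matrix \<open>X = (a, b; c, d)\<close> acts on \<open>\<complex>\<^sup>N\<close> by \<open>z \<mapsto> P z + Q (cnj z)\<close>, with \<open>P\<close> and \<open>Q\<close> as
  below, and \<open>R\<close> is the entrywise conjugate of \<open>Q\<close>.  The formulas extend \<open>P\<close>, \<open>Q\<close>, \<open>R\<close> complex
  linearly to complex matrices.
\<close>

definition cl_P :: "('n::finite) cmat \<Rightarrow> complex ^ 'n ^ 'n" where
  "cl_P X = (\<chi> i j. (blkA X $ i $ j + blkD X $ i $ j + \<i> * (blkC X $ i $ j - blkB X $ i $ j)) / 2)"

definition cl_Q :: "('n::finite) cmat \<Rightarrow> complex ^ 'n ^ 'n" where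
  "cl_Q X = (\<chi> i j. (blkA X $ i $ j - blkD X $ i $ j + \<i> * (blkC X $ i $ j + blkB X $ i $ j)) / 2)"

definition cl_R :: "('n::finite) cmat \<Rightarrow> complex ^ 'n ^ 'n" where
  "cl_R X = (\<chi> i j. (blkA X $ i $ j - blkD X $ i $ j - \<i> * (blkC X $ i $ j + blkB X $ i $ j)) / 2)"

text \<open>
  For \<open>w \<in> \<complex>\<^sup>N\<close> put \<open>\<rho>(w) = sqrt pi * (\<Sum>j. cnj (w j) * z j - w j * \<partial>j)\<close>.  Then
  \<open>[\<rho>(w), \<rho>(w')] = 2 * pi * \<i> * \<langle>w, w'\<rangle>\<close>, so that \<open>\<rho>\<close> is the Fock representation of the Heisenberg
  Lie algebra with central character \<open>t \<mapsto> exp (2 * pi * \<i> * t)\<close>.  The operators \<open>fock_lact X\<close> are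
  the quadratic expressions in the \<open>z j\<close> and \<open>\<partial>j\<close>, symmetrically ordered, with
  \<open>[fock_lact X, \<rho>(w)] = \<rho>(X w)\<close>.
\<close>

definition fock_lact ::
  "('n::finite) cmat \<Rightarrow> (complex ^ 'n \<Rightarrow> complex) \<Rightarrow> complex ^ 'n \<Rightarrow> complex" where
  "fock_lact X p z =
     - (\<Sum>j\<in>UNIV. \<Sum>k\<in>UNIV. cl_P X $ j $ k * z $ k * partial_deriv j p z)
     - (\<Sum>j\<in>UNIV. cl_P X $ j $ j) / 2 * p z
     + (\<Sum>j\<in>UNIV. \<Sum>k\<in>UNIV. cl_R X $ j $ k * z $ j * z $ k) / 2 * p z
     - (\<Sum>j\<in>UNIV. \<Sum>k\<in>UNIV. cl_Q X $ j $ k * partial_deriv j (partial_deriv k p) z) / 2"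

text \<open>
  This is used only for \<open>k\<close> over \<open>maxU\<close>.  There \<open>(snd k (\<i> I))\<^sup>2\<close> is the determinant of the unitary
  matrix of \<open>k\<close>, i.e. \<open>k\<close> acts by \<open>det\<^sup>-\<^sup>1\<^sup>/\<^sup>2\<close> times composition with the inverse matrix.
  This is the integrated form of \<open>fock_lact\<close>.
\<close>

definition fock_gact ::
  "('n::finite) mp \<Rightarrow> (complex ^ 'n \<Rightarrow> complex) \<Rightarrow> complex ^ 'n \<Rightarrow> complex" where
  "fock_gact k p z = inverse (snd k (mat \<i>)) * p (matrix_inv (unitary_of (fst k)) *v z)"

definition fock :: "('n::finite, complex ^ 'n \<Rightarrow> complex) gkmodule" where
  "fock = \<lparr> vecs = (\<Union>d. poly_deg_le d), scl = (\<lambda>c p z. c * p z),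
            gact = fock_gact, lact = fock_lact \<rparr>"

definition Ktype_deg :: "('n::finite) rmat set \<Rightarrow> ('n, 's::ab_group_add) kmodule \<Rightarrow> nat" where
  "Ktype_deg G \<sigma> = (LEAST d. \<exists>p \<in> isotypic (coverK G) fock \<sigma>. p \<noteq> 0 \<and> poly_degree p = d)"

section \<open>Tensor products and theta lifts\<close>

text \<open>
  The algebraic tensor product of \<open>vecs M\<close> and \<open>vecs N\<close> is realised in the dual of the space of
  bilinear forms on them: \<open>v \<otimes> w\<close> is evaluation at \<open>(v, w)\<close>, and the tensor product is the span
  of these elements.
\<close>

type_synonym ('v, 'w) tens = "('v \<Rightarrow> 'w \<Rightarrow> complex) \<Rightarrow> complex"

definition bilinear_forms :: "('k, 'v::ab_group_add, 'z) kmod_scheme \<Rightarrow>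
    ('l, 'w::ab_group_add, 'y) kmod_scheme \<Rightarrow> ('v \<Rightarrow> 'w \<Rightarrow> complex) set" where
  "bilinear_forms M N = {\<beta>. (\<forall>v\<in>vecs M. functional_on N (\<lambda>w. \<beta> v w)) \<and>
                            (\<forall>w\<in>vecs N. functional_on M (\<lambda>v. \<beta> v w))}"

definition pure_tensor :: "('k, 'v::ab_group_add, 'z) kmod_scheme \<Rightarrow>
    ('l, 'w::ab_group_add, 'y) kmod_scheme \<Rightarrow> 'v \<Rightarrow> 'w \<Rightarrow> ('v, 'w) tens" where
  "pure_tensor M N v w = (\<lambda>\<beta>. if \<beta> \<in> bilinear_forms M N then \<beta> v w else 0)"

definition tensor_space :: "('k, 'v::ab_group_add, 'z) kmod_scheme \<Rightarrow>
    ('l, 'w::ab_group_add, 'y) kmod_scheme \<Rightarrow> ('v, 'w) tens set" where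
  "tensor_space M N = module.span (\<lambda>c t \<beta>. c * t \<beta>)
     {pure_tensor M N v w | v w. v \<in> vecs M \<and> w \<in> vecs N}"

text \<open>The operator \<open>A \<otimes> B\<close>, which sends \<open>v \<otimes> w\<close> to \<open>A v \<otimes> B w\<close>.\<close>

definition tensor_op :: "('k, 'v::ab_group_add, 'z) kmod_scheme \<Rightarrow>
    ('l, 'w::ab_group_add, 'y) kmod_scheme \<Rightarrow> ('v \<Rightarrow> 'v) \<Rightarrow> ('w \<Rightarrow> 'w) \<Rightarrow>
    ('v, 'w) tens \<Rightarrow> ('v, 'w) tens" where
  "tensor_op M N A B t =
     (\<lambda>\<beta>. if \<beta> \<in> bilinear_forms M N then t (\<lambda>v w. \<beta> (A v) (B w)) else 0)"

definition howe_kernel :: "('n::finite) rmat set \<Rightarrow> ('n, 'v::ab_group_add) gkmodule \<Rightarrow>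
    (complex ^ 'n \<Rightarrow> complex) set" where
  "howe_kernel G \<pi> = {p \<in> vecs fock. \<forall>T \<in> Hom_gK G fock \<pi>. T p = 0}"

text \<open>
  \<open>\<Theta>\<close> is a big theta lift of \<open>\<pi>\<close>.  The isomorphism of the quotient of \<open>fock\<close> by \<open>howe_kernel G \<pi>\<close>
  with \<open>\<pi> \<otimes> \<Theta>\<close> is given as an equivariant map \<open>\<Phi>\<close> of \<open>fock\<close> onto \<open>\<pi> \<otimes> \<Theta>\<close> with that kernel.
\<close>

definition is_big_theta :: "('n::finite) rmat set \<Rightarrow> 'n rmat set \<Rightarrow>
    ('n, 'v::ab_group_add) gkmodule \<Rightarrow> ('n, 'w::ab_group_add) gkmodule \<Rightarrow> bool" where
  "is_big_theta G G' \<pi> \<Theta> \<longleftrightarrow> gK_module G' \<Theta> \<and>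
     (\<exists>\<Phi> :: (complex ^ 'n \<Rightarrow> complex) \<Rightarrow> ('v, 'w) tens.
        linear_on fock (\<lambda>c t \<beta>. c * t \<beta>) \<Phi> \<and>
        \<Phi> ` vecs fock = tensor_space \<pi> \<Theta> \<and>
        {p \<in> vecs fock. \<Phi> p = 0} = howe_kernel G \<pi> \<and>
        (\<forall>p\<in>vecs fock.
           (\<forall>k\<in>coverK G. \<Phi> (gact fock k p) = tensor_op \<pi> \<Theta> (gact \<pi> k) id (\<Phi> p)) \<and>
           (\<forall>X\<in>complex_Lie G. \<Phi> (lact fock X p) = tensor_op \<pi> \<Theta> (lact \<pi> X) id (\<Phi> p)) \<and>
           (\<forall>k\<in>coverK G'. \<Phi> (gact fock k p) = tensor_op \<pi> \<Theta> id (gact \<Theta> k) (\<Phi> p)) \<and>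
           (\<forall>X\<in>complex_Lie G'. \<Phi> (lact fock X p) = tensor_op \<pi> \<Theta> id (lact \<Theta> X) (\<Phi> p))))"

text \<open>
  \<open>\<theta>\<close> is the theta lift of \<open>\<pi>\<close>, obtained from \<open>\<Theta>\<close>; the zero module is the theta lift if
  \<open>\<Theta> = 0\<close>.  That \<open>\<Theta>\<close> exists, is finitely generated and admissible, and is unique up to isomorphism,
  and that it has a unique irreducible quotient if it is not zero, are theorems of Howe and not
  part of the definition.
\<close>

definition is_theta_lift :: "('n::finite) rmat set \<Rightarrow> 'n rmat set \<Rightarrow>
    ('n, 'v::ab_group_add) gkmodule \<Rightarrow> ('n, 'w::ab_group_add) gkmodule \<Rightarrow>
    ('n, 'u::ab_group_add) gkmodule \<Rightarrow> bool" where
  "is_theta_lift G G' \<pi> \<Theta> \<theta> \<longleftrightarrow> is_big_theta G G' \<pi> \<Theta> \<and>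
     (if vecs \<Theta> = {0} then gK_module G' \<theta> \<and> vecs \<theta> = {0}
      else irreducible_gK_module G' \<theta> \<and> (\<exists>T\<in>Hom_gK G' \<Theta> \<theta>. T ` vecs \<Theta> = vecs \<theta>))"

end

theory Submission
  imports Defs
begin

text \<open>
  The element \<open>-1\<close> of \<open>Sp\<close> is contained in \<open>G\<close>, and a lift of it to the metaplectic group acts on the
  Fock space by a constant times \<open>p(z) \<mapsto> p(-z)\<close>.  The even and the odd polynomials are submodules
  for all operators in question, so one of them maps onto the irreducible quotient \<open>\<pi>\<close>, and the lift
  acts on \<open>\<pi>\<close> by a scalar.  It acts by the same scalar on every \<open>K\<close>-type of \<open>\<pi>\<close>, whose isotypic
  subspace in the Fock space therefore has the corresponding parity.  A \<open>K\<close>-type of the quotient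
  occurs in the Fock space itself because the kernel has an invariant complement in each degree,
  by unitary invariance of an inner product.
\<close>

text \<open>No averaging over \<open>coverK G\<close> takes place: each operator
  \<open>fock_gact k\<close> with \<open>k\<close> over \<open>maxU\<close> multiplies an explicit
  inner product by a constant, so orthogonality is preserved operator by operator. Linear
  substitutions respect a degree bound, so the group action can be studied on a finite-dimensional
  space, where orthogonal projections exist by Gram-Schmidt. The Lie algebra operators can raise the
  degree; they enter through the irreducibility of \<pi>. The non-zero theta lift is used in the
  form of one non-zero equivariant map from the Fock space to \<pi>. The constant in the action of
  the lift of -1 is the inverse of i^N: the automorphy factor of -1 is the constant matrix -1, whose
  determinant (-1)^N has the constant square root i^N. This constant is common to all polynomials,
  so the scalar on \<pi> reveals a sign, and that sign is the parity.\<close>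

section \<open>Polynomials with a degree bound, generated inductively\<close>

text \<open>The index is an upper bound, not the degree. Induction over these rules replaces
  manipulation of coefficients in the proofs about substitution, differentiation and parity.\<close>

inductive polyp :: "nat \<Rightarrow> (complex ^ 'n::finite \<Rightarrow> complex) \<Rightarrow> bool" where
  const: "polyp d (\<lambda>z. c)"
| mult: "polyp d p \<Longrightarrow> polyp (Suc d) (\<lambda>z. z $ i * p z)"
| add: "polyp d p \<Longrightarrow> polyp d q \<Longrightarrow> polyp d (\<lambda>z. p z + q z)"

lemma polyp_scale: "polyp d p \<Longrightarrow> polyp d (\<lambda>z. c * p z)"
proof (induction rule: polyp.induct)
  case (mult d p i)
  have "polyp (Suc d) (\<lambda>z. z $ i * (c * p z))" by (rule polyp.mult) fact
  then show ?case by (simp add: mult_ac)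
qed (auto simp: algebra_simps intro: polyp.intros)

lemma polyp_uminus: "polyp d p \<Longrightarrow> polyp d (\<lambda>z. - p z)"
  using polyp_scale[of d p "-1"] by simp

lemma polyp_diff: "polyp d p \<Longrightarrow> polyp d q \<Longrightarrow> polyp d (\<lambda>z. p z - q z)"
  using polyp.add[OF _ polyp_uminus] by fastforce

lemma polyp_sum: "(\<And>i. i \<in> I \<Longrightarrow> polyp d (f i)) \<Longrightarrow> polyp d (\<lambda>z. \<Sum>i\<in>I. f i z)"
  by (induction I rule: infinite_finite_induct) (auto intro: polyp.intros)

lemma polyp_Suc: "polyp d p \<Longrightarrow> polyp (Suc d) p"
  by (induction rule: polyp.induct) (auto intro: polyp.intros)

lemma polyp_mono: "polyp d p \<Longrightarrow> d \<le> e \<Longrightarrow> polyp e p"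
  by (induction e) (auto simp: le_Suc_eq intro: polyp_Suc)

lemma polyp_subst:
  fixes A :: "complex ^ 'n ^ 'n::finite"
  shows "polyp d p \<Longrightarrow> polyp d (\<lambda>z. p (A *v z))"
proof (induction rule: polyp.induct)
  case (mult d p i)
  have "polyp (Suc d) (\<lambda>z. \<Sum>k\<in>UNIV. A $ i $ k * (z $ k * p (A *v z)))"
    by (intro polyp_sum polyp_scale polyp.mult mult.IH)
  then show ?case
    by (simp add: matrix_vector_mult_def sum_distrib_right mult.assoc)
qed (auto intro: polyp.intros)

lemma polyp_0: "polyp d p \<Longrightarrow> d = 0 \<Longrightarrow> \<exists>c. p = (\<lambda>z. c)"
  by (induction rule: polyp.induct) auto

lemma polyp_monomial:
  "(\<Sum>i\<in>UNIV. \<alpha> i) \<le> d \<Longrightarrow> polyp d (\<lambda>z. \<Prod>i\<in>UNIV. z $ i ^ \<alpha> i)"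
proof (induction d arbitrary: \<alpha>)
  case 0
  then show ?case by (auto intro: polyp.const)
next
  case (Suc d)
  show ?case
  proof (cases "\<exists>i. \<alpha> i \<noteq> 0")
    case False
    then show ?thesis by (auto intro: polyp.const)
  next
    case True
    then obtain i where i: "\<alpha> i \<noteq> 0" by blast
    \<comment> \<open>Lowering one positive exponent splits off a single coordinate, which is what
      the rule \<open>mult\<close> adds.\<close>
    define \<beta> where "\<beta> = \<alpha>(i := \<alpha> i - 1)"
    have "(\<Sum>j\<in>UNIV. \<alpha> j) = Suc (\<Sum>j\<in>UNIV. \<beta> j)"
      using i by (simp add: sum.remove[of UNIV i] \<beta>_def)
    then have "polyp (Suc d) (\<lambda>z. z $ i * (\<Prod>i\<in>UNIV. z $ i ^ \<beta> i))"
      using Suc by (intro polyp.mult) auto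
    moreover have "z $ i * (\<Prod>i\<in>UNIV. z $ i ^ \<beta> i) = (\<Prod>i\<in>UNIV. z $ i ^ \<alpha> i)" for z :: "complex ^ 'a"
      using i by (simp add: prod.remove[of UNIV i] \<beta>_def power_eq_if[of _ "\<alpha> i"])
    ultimately show ?thesis by simp
  qed
qed

lemma finite_exponents: "finite {\<alpha> :: 'n::finite \<Rightarrow> nat. (\<Sum>i\<in>UNIV. \<alpha> i) \<le> d}"
proof (rule finite_subset)
  have "\<alpha> i \<le> d" if "(\<Sum>i\<in>UNIV. \<alpha> i) \<le> d" for \<alpha> :: "'n \<Rightarrow> nat" and i
    using member_le_sum[of i UNIV \<alpha>] that by simp
  then show "{\<alpha> :: 'n \<Rightarrow> nat. (\<Sum>i\<in>UNIV. \<alpha> i) \<le> d} \<subseteq> (\<Pi>\<^sub>E i\<in>UNIV. {..d})"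
    by (auto simp: PiE_def)
  show "finite (\<Pi>\<^sub>E i\<in>(UNIV :: 'n set). {..d})"
    by (intro finite_PiE) auto
qed

lemma poly_deg_le_add:
  "p \<in> poly_deg_le d \<Longrightarrow> q \<in> poly_deg_le d \<Longrightarrow> (\<lambda>z. p z + q z) \<in> poly_deg_le d"
  unfolding poly_deg_le_def
proof (clarsimp, rename_tac a b)
  fix a b :: "('a \<Rightarrow> nat) \<Rightarrow> complex"
  show "\<exists>c. \<forall>z. (\<Sum>\<alpha> | sum \<alpha> UNIV \<le> d. a \<alpha> * (\<Prod>i\<in>UNIV. z $ i ^ \<alpha> i)) +
      (\<Sum>\<alpha> | sum \<alpha> UNIV \<le> d. b \<alpha> * (\<Prod>i\<in>UNIV. z $ i ^ \<alpha> i)) =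
      (\<Sum>\<alpha> | sum \<alpha> UNIV \<le> d. c \<alpha> * (\<Prod>i\<in>UNIV. z $ i ^ \<alpha> i))"
    by (rule exI[of _ "\<lambda>\<alpha>. a \<alpha> + b \<alpha>"]) (simp add: distrib_right sum.distrib)
qed

text \<open>This transfers everything proved by induction to the coefficient description of the Fock
  space. The work lies in multiplication by a coordinate, which shifts the coefficient
  family.\<close>

lemma poly_deg_le_iff: "p \<in> poly_deg_le d \<longleftrightarrow> polyp d p"
proof
  assume "p \<in> poly_deg_le d"
  then obtain c where "p = (\<lambda>z. \<Sum>\<alpha> | (\<Sum>i\<in>UNIV. \<alpha> i) \<le> d. c \<alpha> * (\<Prod>i\<in>UNIV. z $ i ^ \<alpha> i))"
    unfolding poly_deg_le_def by auto
  then show "polyp d p"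
    by (auto intro!: polyp_sum polyp_scale polyp_monomial)
next
  assume "polyp d p"
  then show "p \<in> poly_deg_le d"
  proof (induction rule: polyp.induct)
    case (const d c)
    have "(\<Sum>\<alpha> | (\<Sum>i\<in>UNIV. \<alpha> i) \<le> d. (if \<alpha> = (\<lambda>_. 0) then c else 0) * (\<Prod>i\<in>UNIV. z $ i ^ \<alpha> i)) = c"
      for z :: "complex ^ 'a"
      by (simp add: finite_exponents if_distrib[of "\<lambda>x. x * _"] cong: if_cong)
    then show ?case unfolding poly_deg_le_def by (intro CollectI exI allI) (rule sym)
  next
    case (mult d p i)
    then obtain c where c: "p = (\<lambda>z. \<Sum>\<alpha> | (\<Sum>i\<in>UNIV. \<alpha> i) \<le> d. c \<alpha> * (\<Prod>i\<in>UNIV. z $ i ^ \<alpha> i))"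
      unfolding poly_deg_le_def by auto
    \<comment> \<open>Multiplication by \<open>z $ i\<close> shifts exponents by \<open>up\<close>,
      and \<open>down\<close> undoes it. Exponents with \<open>\<alpha> i = 0\<close> are not in the
      range of \<open>up\<close>, so the new coefficients are 0 there.\<close>
    define up :: "('a \<Rightarrow> nat) \<Rightarrow> 'a \<Rightarrow> nat" where "up \<alpha> = \<alpha>(i := Suc (\<alpha> i))" for \<alpha>
    define down :: "('a \<Rightarrow> nat) \<Rightarrow> 'a \<Rightarrow> nat" where "down \<alpha> = \<alpha>(i := \<alpha> i - 1)" for \<alpha>
    have down_up: "down (up \<alpha>) = \<alpha>" for \<alpha> by (auto simp: up_def down_def)
    have sum_up: "(\<Sum>j\<in>UNIV. up \<alpha> j) = Suc (\<Sum>j\<in>UNIV. \<alpha> j)" for \<alpha>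
      by (simp add: sum.remove[of UNIV i] up_def)
    have prod_up: "(\<Prod>j\<in>UNIV. z $ j ^ up \<alpha> j) = z $ i * (\<Prod>j\<in>UNIV. z $ j ^ \<alpha> j)"
      for \<alpha> and z :: "complex ^ 'a"
      by (simp add: prod.remove[of UNIV i] up_def)
    have "z $ i * p z = (\<Sum>\<alpha> | (\<Sum>i\<in>UNIV. \<alpha> i) \<le> Suc d.
       (if \<alpha> i = 0 then 0 else c (down \<alpha>)) * (\<Prod>i\<in>UNIV. z $ i ^ \<alpha> i))" (is "_ = sum ?f ?S")
      for z :: "complex ^ 'a"
    proof -
      have "z $ i * p z = (\<Sum>\<alpha> | (\<Sum>i\<in>UNIV. \<alpha> i) \<le> d. c \<alpha> * (\<Prod>j\<in>UNIV. z $ j ^ up \<alpha> j))"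
        by (simp add: c sum_distrib_left prod_up mult_ac)
      also have "\<dots> = (\<Sum>\<alpha> \<in> up ` {\<alpha>. (\<Sum>i\<in>UNIV. \<alpha> i) \<le> d}. c (down \<alpha>) * (\<Prod>j\<in>UNIV. z $ j ^ \<alpha> j))"
        by (subst sum.reindex) (auto intro!: inj_on_inverseI[of _ down] simp: down_up)
      also have "\<dots> = sum ?f (up ` {\<alpha>. (\<Sum>i\<in>UNIV. \<alpha> i) \<le> d})"
        by (intro sum.cong) (auto simp: up_def)
      also have "\<dots> = sum ?f ?S"
      proof (rule sum.mono_neutral_left[OF finite_exponents])
        show "\<forall>\<alpha>\<in>?S - up ` {\<alpha>. (\<Sum>i\<in>UNIV. \<alpha> i) \<le> d}. ?f \<alpha> = 0"
        proof
          fix \<alpha> assume a: "\<alpha> \<in> ?S - up ` {\<alpha>. (\<Sum>i\<in>UNIV. \<alpha> i) \<le> d}"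
          show "?f \<alpha> = 0"
          proof (cases "\<alpha> i = 0")
            case False
            then have "\<alpha> = up (down \<alpha>)" by (auto simp: up_def down_def)
            then show ?thesis using a sum_up[of "down \<alpha>"] by (auto simp: image_iff)
          qed simp
        qed
      qed (auto simp: sum_up)
      finally show ?thesis .
    qed
    then show ?case unfolding poly_deg_le_def by (intro CollectI exI allI)
  next
    case (add d p q)
    then show ?case by (simp add: poly_deg_le_add)
  qed
qed

section \<open>Derivatives of polynomials\<close>

text \<open>A partial derivative is the directional derivative along \<open>axis j 1\<close>. Asking
  for all directions at once gives the chain rule for linear substitutions for free.\<close>

lemma partial_deriv_eqI:
  assumes "\<And>z w. ((\<lambda>t. p (z + t *s w)) has_field_derivative (\<Sum>j\<in>UNIV. w $ j * f j z)) (at 0)"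
  shows "partial_deriv j p = f j"
proof
  fix z
  have "(\<lambda>t. p (z + axis j t)) = (\<lambda>t. p (z + t *s axis j 1))"
    by (intro ext arg_cong[of _ _ p]) (simp add: vec_eq_iff axis_def)
  then have "partial_deriv j p z = (\<Sum>i\<in>UNIV. axis j 1 $ i * f i z)"
    using DERIV_imp_deriv[OF assms[of z "axis j 1"]] by (simp add: partial_deriv_def)
  then show "partial_deriv j p z = f j z"
    by (simp add: axis_def if_distrib[of "\<lambda>x. x * _"] cong: if_cong)
qed

text \<open>The claims are proved in one induction because the product rule for \<open>mult\<close>
  needs the directional derivative of the smaller polynomial. The clause for \<open>d = 0\<close>
  repairs truncated subtraction: there the bound \<open>d - 1\<close> is still 0, and
  \<open>z $ i\<close> times a derivative has bound 0 only if that derivative vanishes.\<close>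

lemma polyp_deriv:
  assumes "polyp d p"
  shows "(\<forall>j. polyp (d - 1) (partial_deriv j p) \<and> (d = 0 \<longrightarrow> partial_deriv j p = (\<lambda>z. 0))) \<and>
     (\<forall>z w. ((\<lambda>t. p (z + t *s w)) has_field_derivative (\<Sum>j\<in>UNIV. w $ j * partial_deriv j p z)) (at 0))"
  using assms
proof (induction rule: polyp.induct)
    case (const d c)
    have "((\<lambda>t. c) has_field_derivative (\<Sum>j\<in>UNIV. w $ j * (\<lambda>j z. 0) j z)) (at 0)" for z w :: "complex ^ 'a"
      by simp
    from this partial_deriv_eqI[of "\<lambda>z. c" "\<lambda>j z. 0"] show ?case by (auto intro: polyp.const)
  next
    case (mult d p i)
    define f where "f j z = (if i = j then p z else 0) + z $ i * partial_deriv j p z" for j z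
    have D: "((\<lambda>t. (z + t *s w) $ i * p (z + t *s w)) has_field_derivative (\<Sum>j\<in>UNIV. w $ j * f j z)) (at 0)" for z w
    proof -
      have "((\<lambda>t. (z + t *s w) $ i * p (z + t *s w)) has_field_derivative
         w $ i * p z + (\<Sum>j\<in>UNIV. w $ j * partial_deriv j p z) * z $ i) (at 0)"
      proof -
        have "((\<lambda>t. (z + t *s w) $ i) has_field_derivative w $ i) (at 0)"
          by (auto intro!: derivative_eq_intros)
        from DERIV_mult[OF this mult.IH[THEN conjunct2, rule_format]] show ?thesis by simp
      qed
      moreover have "w $ i * p z + (\<Sum>j\<in>UNIV. w $ j * partial_deriv j p z) * z $ i = (\<Sum>j\<in>UNIV. w $ j * f j z)"
        by (simp add: f_def distrib_left sum.distrib sum_distrib_left mult_ac if_distrib[of "\<lambda>x. _ * x"] cong: if_cong)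
      ultimately show ?thesis by simp
    qed
    have e: "partial_deriv j (\<lambda>z. z $ i * p z) = f j" for j by (rule partial_deriv_eqI) (rule D)
    have "polyp d (f j)" for j
    proof -
      have "polyp d (\<lambda>z. z $ i * partial_deriv j p z)"
      proof (cases d)
        case 0
        then show ?thesis using mult.IH by (auto intro: polyp.const)
      next
        case (Suc e)
        then show ?thesis using mult.IH polyp.mult[of e] by auto
      qed
      moreover have "polyp d (\<lambda>z. if i = j then p z else 0)"
        using mult.hyps polyp.const[of d 0] by (cases "i = j") simp_all
      ultimately show ?thesis unfolding f_def by (intro polyp.add)
    qed
    then show ?case using D by (simp add: e)
  next
    case (add d p q)
    define f where "f j z = partial_deriv j p z + partial_deriv j q z" for j z
    have D: "((\<lambda>t. p (z + t *s w) + q (z + t *s w)) has_field_derivative (\<Sum>j\<in>UNIV. w $ j * f j z)) (at 0)" for z w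
      using DERIV_add[OF add.IH(1)[THEN conjunct2, rule_format] add.IH(2)[THEN conjunct2, rule_format], of z w z w]
      by (simp add: f_def distrib_left sum.distrib)
    have e: "partial_deriv j (\<lambda>z. p z + q z) = f j" for j by (rule partial_deriv_eqI) (rule D)
    have "polyp (d - 1) (f j)" for j
      unfolding f_def using add.IH by (intro polyp.add) auto
    moreover have "d = 0 \<Longrightarrow> f j = (\<lambda>z. 0)" for j
      using add.IH by (simp add: f_def fun_eq_iff)
    ultimately show ?case using D by (simp add: e)
qed

lemma polyp_partial_deriv: "polyp d p \<Longrightarrow> polyp (d - 1) (partial_deriv j p)"
  using polyp_deriv by blast

lemma polyp_directional:
  "polyp d p \<Longrightarrow>
    ((\<lambda>t. p (z + t *s w)) has_field_derivative (\<Sum>j\<in>UNIV. w $ j * partial_deriv j p z)) (at 0)"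
  using polyp_deriv by blast

text \<open>Along the ray through \<open>z\<close>, the derivative at parameter \<open>t\<close> is
  the directional derivative at \<open>t *s z\<close>, moved to 0 by a shift; it vanishes, so the
  two ends 0 and \<open>z\<close> of the ray carry the same value.\<close>

lemma polyp_constant:
  assumes p: "polyp d p" and "\<And>j. partial_deriv j p = (\<lambda>z. 0)"
  shows "p z = p 0"
proof -
  have "((\<lambda>t. p (t *s z)) has_field_derivative 0) (at t)" for t
    using polyp_directional[OF p, of "t *s z" z] DERIV_shift[of "\<lambda>t. p (t *s z)" 0 0 t]
    by (simp add: assms(2) algebra_simps vector_sadd_rdistrib)
  then have "\<exists>c. \<forall>t. p (t *s z) = c"
    using has_field_derivative_zero_constant[of UNIV "\<lambda>t. p (t *s z)"] by auto
  then show ?thesis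
    by (metis vector_smult_lid vector_smult_lzero)
qed

section \<open>Closure properties of the Fock space\<close>

lemma vecs_fock_iff: "p \<in> vecs fock \<longleftrightarrow> (\<exists>d. polyp d p)"
  by (simp add: fock_def poly_deg_le_iff)

lemma scl_fock [simp]: "scl fock = (\<lambda>c p z. c * p z)"
  by (simp add: fock_def)

lemma gact_fock [simp]: "gact fock = fock_gact"
  by (simp add: fock_def)

lemma lact_fock [simp]: "lact fock = fock_lact"
  by (simp add: fock_def)

lemma fock_const: "(\<lambda>z. c) \<in> vecs fock"
  by (auto simp: vecs_fock_iff intro: polyp.const)

lemma fock_add: "p \<in> vecs fock \<Longrightarrow> q \<in> vecs fock \<Longrightarrow> (\<lambda>z. p z + q z) \<in> vecs fock"
  unfolding vecs_fock_iff by (metis polyp.add polyp_mono max.cobounded1 max.cobounded2)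

lemma fock_scale: "p \<in> vecs fock \<Longrightarrow> (\<lambda>z. c * p z) \<in> vecs fock"
  by (auto simp: vecs_fock_iff intro: polyp_scale)

lemma fock_diff: "p \<in> vecs fock \<Longrightarrow> q \<in> vecs fock \<Longrightarrow> (\<lambda>z. p z - q z) \<in> vecs fock"
  using fock_add[OF _ fock_scale[of q "-1"]] by simp

lemma fock_sum: "(\<And>i. i \<in> I \<Longrightarrow> f i \<in> vecs fock) \<Longrightarrow> (\<lambda>z. \<Sum>i\<in>I. f i z) \<in> vecs fock"
  by (induction I rule: infinite_finite_induct) (auto intro: fock_const fock_add)

lemma fock_coord_mult: "p \<in> vecs fock \<Longrightarrow> (\<lambda>z. z $ i * p z) \<in> vecs fock"
  by (auto simp: vecs_fock_iff intro: polyp.mult)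

lemma fock_partial_deriv: "p \<in> vecs fock \<Longrightarrow> partial_deriv j p \<in> vecs fock"
  by (auto simp: vecs_fock_iff intro: polyp_partial_deriv)

lemma fock_subst:
  fixes A :: "complex ^ 'n ^ 'n::finite"
  shows "p \<in> vecs fock \<Longrightarrow> (\<lambda>z. p (A *v z)) \<in> vecs fock"
  by (auto simp: vecs_fock_iff intro: polyp_subst)

lemma fock_directional:
  "p \<in> vecs fock \<Longrightarrow>
    ((\<lambda>t. p (z + t *s w)) has_field_derivative (\<Sum>j\<in>UNIV. w $ j * partial_deriv j p z)) (at 0)"
  by (auto simp: vecs_fock_iff intro: polyp_directional)

lemma partial_deriv_add:
  assumes "p \<in> vecs fock" "q \<in> vecs fock"
  shows "partial_deriv j (\<lambda>z. p z + q z) = (\<lambda>z. partial_deriv j p z + partial_deriv j q z)"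
  using DERIV_add[OF fock_directional[OF assms(1)] fock_directional[OF assms(2)]]
  by (intro partial_deriv_eqI[where f = "\<lambda>j z. partial_deriv j p z + partial_deriv j q z"])
     (simp add: distrib_left sum.distrib)

lemma partial_deriv_scale:
  assumes "p \<in> vecs fock"
  shows "partial_deriv j (\<lambda>z. c * p z) = (\<lambda>z. c * partial_deriv j p z)"
  using DERIV_cmult[OF fock_directional[OF assms], of c]
  by (intro partial_deriv_eqI[where f = "\<lambda>j z. c * partial_deriv j p z"])
     (simp add: sum_distrib_left mult_ac)

lemma partial_deriv_subst:
  fixes A :: "complex ^ 'n ^ 'n::finite"
  assumes "p \<in> vecs fock"
  shows "partial_deriv j (\<lambda>z. p (A *v z)) = (\<lambda>z. \<Sum>i\<in>UNIV. A $ i $ j * partial_deriv i p (A *v z))"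
proof (rule partial_deriv_eqI[where f = "\<lambda>j z. \<Sum>i\<in>UNIV. A $ i $ j * partial_deriv i p (A *v z)"])
  fix z w
  have "(\<Sum>i\<in>UNIV. (A *v w) $ i * partial_deriv i p (A *v z)) =
        (\<Sum>i\<in>UNIV. \<Sum>j\<in>UNIV. w $ j * (A $ i $ j * partial_deriv i p (A *v z)))"
    by (simp add: matrix_vector_mult_def sum_distrib_right mult_ac)
  also have "\<dots> = (\<Sum>j\<in>UNIV. w $ j * (\<Sum>i\<in>UNIV. A $ i $ j * partial_deriv i p (A *v z)))"
    by (subst sum.swap) (simp add: sum_distrib_left)
  finally show "((\<lambda>t. p (A *v (z + t *s w))) has_field_derivative
      (\<Sum>j\<in>UNIV. w $ j * (\<Sum>i\<in>UNIV. A $ i $ j * partial_deriv i p (A *v z)))) (at 0)"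
    using fock_directional[OF assms, of "A *v z" "A *v w"]
    by (simp add: matrix_vector_right_distrib vector_scalar_commute)
qed

section \<open>An inner product on polynomials of bounded degree\<close>

text \<open>The Frobenius pairing of the \<open>k\<close>-th derivative tensors at \<open>0\<close>; summed over \<open>k\<close> it is the Fock
  inner product up to weights, and in this form its unitary invariance follows from the chain rule
  without integration.\<close>

primrec polar :: "nat \<Rightarrow> (complex ^ 'n::finite \<Rightarrow> complex) \<Rightarrow> (complex ^ 'n \<Rightarrow> complex) \<Rightarrow> complex" where
  "polar 0 p q = p 0 * cnj (q 0)"
| "polar (Suc k) p q = (\<Sum>j\<in>UNIV. polar k (partial_deriv j p) (partial_deriv j q))"

lemma polar_cnj: "cnj (polar k p q) = polar k q p"
  by (induction k arbitrary: p q) (auto simp: mult.commute)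

lemma polar_add_left:
  "p \<in> vecs fock \<Longrightarrow> q \<in> vecs fock \<Longrightarrow> polar k (\<lambda>z. p z + q z) r = polar k p r + polar k q r"
  by (induction k arbitrary: p q r)
     (simp_all add: distrib_right partial_deriv_add fock_partial_deriv sum.distrib)

lemma polar_scale_left:
  "p \<in> vecs fock \<Longrightarrow> polar k (\<lambda>z. c * p z) r = c * polar k p r"
  by (induction k arbitrary: p r)
     (simp_all add: partial_deriv_scale fock_partial_deriv sum_distrib_left)

lemma polar_sum_left:
  assumes "\<And>i. i \<in> I \<Longrightarrow> f i \<in> vecs fock"
  shows "polar k (\<lambda>z. \<Sum>i\<in>I. a i * f i z) r = (\<Sum>i\<in>I. a i * polar k (f i) r)"
proof -
  have 0: "polar k (\<lambda>z. 0) r = 0" using polar_scale_left[OF fock_const, of k 0 0 r] by simp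
  show ?thesis using assms
  proof (induction I rule: infinite_finite_induct)
    case (insert i I)
    then have "polar k (\<lambda>z. a i * f i z + (\<Sum>i\<in>I. a i * f i z)) r =
      a i * polar k (f i) r + polar k (\<lambda>z. \<Sum>i\<in>I. a i * f i z) r"
      by (subst polar_add_left) (auto intro!: fock_scale fock_sum polar_scale_left)
    then show ?case using insert by simp
  qed (simp_all add: 0)
qed

lemma polar_sum_right:
  assumes "\<And>i. i \<in> I \<Longrightarrow> f i \<in> vecs fock"
  shows "polar k r (\<lambda>z. \<Sum>i\<in>I. a i * f i z) = (\<Sum>i\<in>I. cnj (a i) * polar k r (f i))"
proof -
  have "cnj (polar k (\<lambda>z. \<Sum>i\<in>I. a i * f i z) r) = cnj (\<Sum>i\<in>I. a i * polar k (f i) r)"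
    using assms by (simp add: polar_sum_left)
  then show ?thesis by (simp add: polar_cnj)
qed

text \<open>By the chain rule, differentiating both arguments produces the coefficients
  \<open>A $ j $ i * cnj (A $ l $ i)\<close>. Summing over \<open>i\<close> uses the orthonormality
  of the rows of \<open>A\<close> and leaves the diagonal terms.\<close>

lemma polar_unitary:
  fixes A :: "complex ^ 'n ^ 'n::finite"
  assumes A: "\<And>j l. (\<Sum>i\<in>UNIV. A $ j $ i * cnj (A $ l $ i)) = (if j = l then 1 else 0)"
  shows "p \<in> vecs fock \<Longrightarrow> q \<in> vecs fock \<Longrightarrow> polar k (\<lambda>z. p (A *v z)) (\<lambda>z. q (A *v z)) = polar k p q"
proof (induction k arbitrary: p q)
  case 0
  then show ?case by simp
next
  case (Suc k)
  let ?B = "\<lambda>j l. polar k (\<lambda>z. partial_deriv j p (A *v z)) (\<lambda>z. partial_deriv l q (A *v z))"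
  have "polar (Suc k) (\<lambda>z. p (A *v z)) (\<lambda>z. q (A *v z)) =
    (\<Sum>i\<in>UNIV. \<Sum>j\<in>UNIV. \<Sum>l\<in>UNIV. A $ j $ i * cnj (A $ l $ i) * ?B j l)"
    using Suc.prems
    by (simp add: partial_deriv_subst polar_sum_left polar_sum_right fock_subst fock_partial_deriv
        sum_distrib_left mult_ac)
  also have "\<dots> = (\<Sum>j\<in>UNIV. \<Sum>l\<in>UNIV. \<Sum>i\<in>UNIV. A $ j $ i * cnj (A $ l $ i) * ?B j l)"
    by (subst sum.swap) (intro sum.cong refl sum.swap)
  also have "\<dots> = (\<Sum>j\<in>UNIV. \<Sum>l\<in>UNIV. (if j = l then 1 else 0) * ?B j l)"
    by (simp add: sum_distrib_right[symmetric] A)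
  also have "\<dots> = (\<Sum>j\<in>UNIV. ?B j j)"
    by (simp add: if_distrib[of "\<lambda>x. x * _"] cong: if_cong)
  also have "\<dots> = polar (Suc k) p q"
    using Suc by (simp add: fock_partial_deriv)
  finally show ?case .
qed

lemma polar_self: "0 \<le> Re (polar k p p)" "Im (polar k p p) = 0"
  by (induction k arbitrary: p) (auto simp: sum_nonneg)

text \<open>The pairing at level \<open>Suc k\<close> is a sum of nonnegative terms, so every
  partial derivative satisfies the hypotheses one degree lower and vanishes. Thus \<open>p\<close>
  is constant, and level 0 kills the constant.\<close>

lemma polar_definite:
  "polyp d p \<Longrightarrow> (\<And>k. k \<le> d \<Longrightarrow> polar k p p = 0) \<Longrightarrow> p = (\<lambda>z. 0)"
proof (induction d arbitrary: p)
  case 0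
  then show ?case using polyp_0[of 0 p] by (force dest: spec[of _ 0])
next
  case (Suc d)
  have "partial_deriv j p = (\<lambda>z. 0)" for j
  proof (rule Suc.IH)
    fix k assume "k \<le> d"
    then have "(\<Sum>j\<in>UNIV. Re (polar k (partial_deriv j p) (partial_deriv j p))) = 0"
      using Suc.prems(2)[of "Suc k"] by (simp flip: Re_sum)
    then have "Re (polar k (partial_deriv j p) (partial_deriv j p)) = 0"
      by (simp add: sum_nonneg_eq_0_iff polar_self)
    then show "polar k (partial_deriv j p) (partial_deriv j p) = 0"
      by (simp add: complex_eq_iff polar_self)
  qed (use polyp_partial_deriv[OF Suc.prems(1)] in simp)
  then have "p z = p 0" for z using polyp_constant[OF Suc.prems(1)] by blast
  moreover have "p 0 = 0" using Suc.prems(2)[of 0] by simp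
  ultimately show ?case by auto
qed

text \<open>On polynomials of degree at most \<open>d\<close> all derivatives of higher order are
  zero, so cutting the sum off at \<open>d\<close> loses nothing.\<close>

definition fock_form :: "nat \<Rightarrow> (complex ^ 'n::finite \<Rightarrow> complex) \<Rightarrow> (complex ^ 'n \<Rightarrow> complex) \<Rightarrow> complex" where
  "fock_form d p q = (\<Sum>k\<le>d. polar k p q)"

lemma fock_form_definite:
  assumes "polyp d p" "fock_form d p p = 0"
  shows "p = 0"
proof -
  have "(\<Sum>k\<le>d. Re (polar k p p)) = 0"
    using assms(2) by (simp add: fock_form_def flip: Re_sum)
  then have "Re (polar k p p) = 0" if "k \<le> d" for k
    using that by (simp add: sum_nonneg_eq_0_iff polar_self)
  then have "p = (\<lambda>z. 0)"
    using assms(1) by (intro polar_definite) (auto simp: complex_eq_iff polar_self)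
  then show ?thesis by (simp add: zero_fun_def)
qed

text \<open>The domain type is arbitrary because tensors, being functions on bilinear forms, carry
  the same pointwise scalar multiplication.\<close>

interpretation fock_vs: vector_space "\<lambda>c (p :: 'x \<Rightarrow> complex) z. c * p z"
  by unfold_locales (auto simp: fun_eq_iff algebra_simps)

lemma polyp_fock: "polyp d p \<Longrightarrow> p \<in> vecs fock"
  by (auto simp: vecs_fock_iff)

lemma subspace_fock: "fock_vs.subspace (vecs fock)"
  by (auto simp: fock_vs.subspace_def zero_fun_def plus_fun_def intro: fock_const fock_add fock_scale)

lemma span_sum_pointwise:
  "(\<And>i. i \<in> I \<Longrightarrow> f i \<in> fock_vs.span S) \<Longrightarrow> (\<lambda>z. \<Sum>i\<in>I. f i z) \<in> fock_vs.span S"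
proof (induction I rule: infinite_finite_induct)
  case (insert i I)
  then have "f i + (\<lambda>z. \<Sum>i\<in>I. f i z) \<in> fock_vs.span S"
    by (intro fock_vs.span_add) auto
  then show ?case using insert by (simp add: plus_fun_def)
qed (use fock_vs.span_zero[of S] in \<open>simp_all add: zero_fun_def\<close>)

lemma polyp_finitely_spanned:
  "\<exists>M :: (complex ^ 'n::finite \<Rightarrow> complex) set. finite M \<and> (\<forall>p. polyp d p \<longrightarrow> p \<in> fock_vs.span M)"
proof (intro exI conjI allI impI)
  let ?E = "{\<alpha> :: 'n \<Rightarrow> nat. (\<Sum>i\<in>UNIV. \<alpha> i) \<le> d}"
  let ?m = "\<lambda>\<alpha> (z :: complex ^ 'n). \<Prod>i\<in>UNIV. z $ i ^ \<alpha> i"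
  show "finite (?m ` ?E)" by (intro finite_imageI finite_exponents)
  fix p :: "complex ^ 'n \<Rightarrow> complex" assume "polyp d p"
  then obtain c where "p = (\<lambda>z. \<Sum>\<alpha>\<in>?E. c \<alpha> * ?m \<alpha> z)"
    unfolding poly_deg_le_iff[symmetric] poly_deg_le_def by auto
  then show "p \<in> fock_vs.span (?m ` ?E)"
    by (auto intro!: span_sum_pointwise fock_vs.span_scale intro: fock_vs.span_base)
qed

lemma fock_form_cnj: "cnj (fock_form d p q) = fock_form d q p"
  by (simp add: fock_form_def polar_cnj)

lemma fock_form_add_left:
  "p \<in> vecs fock \<Longrightarrow> q \<in> vecs fock \<Longrightarrow>
    fock_form d (\<lambda>z. p z + q z) r = fock_form d p r + fock_form d q r"
  by (simp add: fock_form_def polar_add_left sum.distrib)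

lemma fock_form_scale_left:
  "p \<in> vecs fock \<Longrightarrow> fock_form d (\<lambda>z. c * p z) r = c * fock_form d p r"
  by (simp add: fock_form_def polar_scale_left sum_distrib_left)

lemma fock_form_diff_left:
  "p \<in> vecs fock \<Longrightarrow> q \<in> vecs fock \<Longrightarrow>
    fock_form d (\<lambda>z. p z - q z) r = fock_form d p r - fock_form d q r"
  using fock_form_add_left[OF _ fock_scale[of q "-1"], of p d r] fock_form_scale_left[of q d "-1" r]
  by simp

lemma fock_form_zero_left: "fock_form d (\<lambda>z. 0) r = 0"
  using fock_form_scale_left[OF fock_const, of d 0 0 r] by simp

lemma fock_form_add_right:
  assumes "p \<in> vecs fock" "q \<in> vecs fock"
  shows "fock_form d r (\<lambda>z. p z + q z) = fock_form d r p + fock_form d r q"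
  using arg_cong[OF fock_form_add_left[OF assms, of d r], of cnj] by (simp add: fock_form_cnj)

lemma fock_form_scale_right:
  assumes "p \<in> vecs fock"
  shows "fock_form d r (\<lambda>z. c * p z) = cnj c * fock_form d r p"
  using arg_cong[OF fock_form_scale_left[OF assms, of d c r], of cnj] by (simp add: fock_form_cnj)

lemma fock_form_zero_right: "fock_form d r (\<lambda>z. 0) = 0"
  using fock_form_scale_right[OF fock_const, of d r 0 0] by simp

lemma subspace_orthogonal: "fock_vs.subspace {s \<in> vecs fock. fock_form d w s = 0}"
  by (auto simp: fock_vs.subspace_def zero_fun_def plus_fun_def fock_form_add_right
      fock_form_scale_right fock_form_zero_right intro: fock_const fock_add fock_scale)

text \<open>Gram-Schmidt, adding one spanning vector \<open>b\<close> at a time. The induction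
  hypothesis serves twice, for \<open>b\<close> and for \<open>w\<close>, and gives their residuals
  \<open>cb\<close> and \<open>cw\<close> orthogonal to the old span.\<close>

lemma fock_projection:
  assumes "finite S" "\<And>s. s \<in> S \<Longrightarrow> polyp d s" "polyp d w"
  shows "\<exists>n. n \<in> fock_vs.span S \<and> polyp d n \<and>
    (\<forall>s\<in>fock_vs.span S. fock_form d (\<lambda>z. w z - n z) s = 0)"
  using assms
proof (induction S arbitrary: w rule: finite_induct)
  case empty
  then show ?case
    by (intro exI[of _ 0]) (auto simp: zero_fun_def fock_form_zero_right intro: polyp.const)
next
  case (insert b S)
  have b: "polyp d b" using insert by simp
  obtain nb where nb: "nb \<in> fock_vs.span S" "polyp d nb"
    "\<And>s. s \<in> fock_vs.span S \<Longrightarrow> fock_form d (\<lambda>z. b z - nb z) s = 0"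
    using insert.IH[OF _ b] insert.prems by auto
  obtain nw where nw: "nw \<in> fock_vs.span S" "polyp d nw"
    "\<And>s. s \<in> fock_vs.span S \<Longrightarrow> fock_form d (\<lambda>z. w z - nw z) s = 0"
    using insert.IH[OF _ insert.prems(2)] insert.prems by auto
  define cb where "cb = (\<lambda>z. b z - nb z)"
  define cw where "cw = (\<lambda>z. w z - nw z)"
  have poly: "polyp d cb" "polyp d cw"
    unfolding cb_def cw_def by (intro polyp_diff b nb nw insert.prems)+
  show ?case
  proof (cases "cb = 0")
    \<comment> \<open>A zero residual means that \<open>b\<close> already lies in the old span, so
      the projection of \<open>w\<close> stays the same.\<close>
    case True
    then have "b = nb" by (auto simp: cb_def fun_eq_iff)
    then show ?thesis using nw nb fock_vs.span_redundant[of b S] by auto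
  next
    case False
    then have nz: "fock_form d cb cb \<noteq> 0" using fock_form_definite[OF poly(1)] by blast
    \<comment> \<open>This coefficient makes \<open>cw - a * cb\<close> orthogonal to
      \<open>cb\<close>; orthogonality to the old span is kept, and together they give orthogonality
      to \<open>b\<close>.\<close>
    define a where "a = fock_form d cw cb / fock_form d cb cb"
    define c where "c = (\<lambda>z. cw z - a * cb z)"
    have c_form: "fock_form d c s = fock_form d cw s - a * fock_form d cb s" for s
      using poly by (simp add: c_def fock_form_diff_left fock_form_scale_left polyp_fock fock_scale)
    have c0: "fock_form d c s = 0" if "s \<in> fock_vs.span S" for s
      using nb(3) nw(3) that by (simp add: c_form cb_def cw_def)
    have "fock_form d c cb = 0" using nz by (simp add: c_form a_def)
    then have "fock_form d c (\<lambda>z. nb z + cb z) = 0"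
      using c0[OF nb(1)] by (simp add: fock_form_add_right polyp_fock[OF nb(2)] polyp_fock[OF poly(1)])
    then have "fock_form d c b = 0" by (simp add: cb_def)
    then have "insert b S \<subseteq> {s \<in> vecs fock. fock_form d c s = 0}"
      using c0 insert.prems(1) polyp_fock by (auto intro: fock_vs.span_base)
    then have ortho: "fock_vs.span (insert b S) \<subseteq> {s \<in> vecs fock. fock_form d c s = 0}"
      by (rule fock_vs.span_minimal[OF _ subspace_orthogonal])
    define n where "n = (\<lambda>z. nw z + a * cb z)"
    have "n = nw + (\<lambda>z. a * (b - nb) z)"
      by (simp add: n_def cb_def fun_eq_iff)
    moreover have "nw \<in> fock_vs.span (insert b S)" "nb \<in> fock_vs.span (insert b S)"
      "b \<in> fock_vs.span (insert b S)"
      using nb nw fock_vs.span_mono[of S "insert b S"] fock_vs.span_base[of b "insert b S"] by auto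
    ultimately have "n \<in> fock_vs.span (insert b S)"
      by (simp only: fock_vs.span_add fock_vs.span_scale fock_vs.span_diff)
    moreover have "polyp d n"
      unfolding n_def by (intro polyp.add polyp_scale nw poly)
    moreover have "(\<lambda>z. w z - n z) = c"
      by (simp add: n_def c_def cw_def fun_eq_iff)
    ultimately show ?thesis using ortho by auto
  qed
qed

section \<open>Unitarity of the compact group on the Fock space\<close>

text \<open>For the matrix a + ic, orthogonality of \<open>u\<close> is the real part of the
  relation and symplecticity is the imaginary part, both read off in the upper left block.\<close>

lemma maxU_unitary:
  assumes "u \<in> maxU"
  shows "(\<Sum>i\<in>UNIV. cnj (unitary_of u $ i $ j) * unitary_of u $ i $ k) = (if j = k then 1 else 0)"
proof -
  have o: "transpose u ** u = mat 1" and s: "transpose u ** symp_J ** u = symp_J"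
    using assms by (auto simp: maxU_def Sp_def orthogonal_matrix)
  have sumP: "(\<Sum>p\<in>UNIV. f p) = (\<Sum>i\<in>UNIV. f (Inl i)) + (\<Sum>i\<in>UNIV. f (Inr i))" for f :: "'a + 'a \<Rightarrow> real"
    by (simp flip: UNIV_Plus_UNIV add: sum.Plus)
  have re: "(\<Sum>i\<in>UNIV. u $ Inl i $ Inl j * u $ Inl i $ Inl k + u $ Inr i $ Inl j * u $ Inr i $ Inl k) =
      (if j = k then 1 else 0)"
    using arg_cong[OF o, of "\<lambda>m. m $ Inl j $ Inl k"]
    by (simp add: matrix_matrix_mult_def transpose_def mat_def sumP sum.distrib)
  have im: "(\<Sum>i\<in>UNIV. u $ Inl i $ Inl j * u $ Inr i $ Inl k - u $ Inr i $ Inl j * u $ Inl i $ Inl k) = 0"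
    using arg_cong[OF s, of "\<lambda>m. m $ Inl j $ Inl k"]
    by (simp add: matrix_matrix_mult_def transpose_def symp_J_def sumP sum.distrib sum_subtractf
        if_distrib[of "\<lambda>x. _ * x"] sum_negf cong: if_cong)
  show ?thesis
    using re im by (simp add: unitary_of_def blkA_def blkC_def complex_eq_iff sum.distrib sum_subtractf
        algebra_simps)
qed

lemma matrix_inv_eqI:
  fixes A B :: "'a::semiring_1 ^ 'm ^ 'm::finite"
  assumes "A ** B = mat 1" "B ** A = mat 1"
  shows "matrix_inv A = B"
  unfolding matrix_inv_def
proof (rule some_equality)
  fix C assume "A ** C = mat 1 \<and> C ** A = mat 1"
  then have "C = C ** (A ** B)" and "(C ** A) ** B = B" using assms by simp_all
  then show "C = B" by (simp add: matrix_mul_assoc)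
qed (use assms in simp)

text \<open>The inverse is the conjugate transpose, so the column relations of the unitary matrix
  become the row relations that \<open>polar_unitary\<close> asks for.\<close>

lemma maxU_inverse_unitary:
  fixes u :: "'n::finite rmat"
  assumes "u \<in> maxU"
  defines "A \<equiv> matrix_inv (unitary_of u)"
  shows "(\<Sum>i\<in>UNIV. A $ j $ i * cnj (A $ l $ i)) = (if j = l then 1 else 0)"
proof -
  let ?U = "unitary_of u"
  define V where "V = (\<chi> i j. cnj (?U $ j $ i))"
  have VU: "V ** ?U = mat 1"
    using maxU_unitary[OF assms(1)] by (simp add: V_def matrix_matrix_mult_def mat_def vec_eq_iff)
  then have UV: "?U ** V = mat 1" by (simp add: matrix_left_right_inverse)
  have "A = V"
    unfolding A_def by (rule matrix_inv_eqI[OF UV VU])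
  then show ?thesis
    using maxU_unitary[OF assms(1), of j l] by (simp add: V_def)
qed

lemma polyp_fock_gact: "polyp d p \<Longrightarrow> polyp d (fock_gact k p)"
  using polyp_scale[OF polyp_subst] by (simp add: fock_gact_def[abs_def])

lemma fock_gact_in_fock: "p \<in> vecs fock \<Longrightarrow> fock_gact k p \<in> vecs fock"
  unfolding vecs_fock_iff by (blast intro: polyp_fock_gact)

text \<open>The factor is the squared modulus of the inverse branch value. It can stay unevaluated,
  since the lemma serves to compare the vanishing of forms.\<close>

lemma fock_form_gact:
  assumes "fst k \<in> maxU" "p \<in> vecs fock" "q \<in> vecs fock"
  shows "fock_form d (fock_gact k p) (fock_gact k q) =
    inverse (snd k (mat \<i>)) * cnj (inverse (snd k (mat \<i>))) * fock_form d p q"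
proof -
  let ?A = "matrix_inv (unitary_of (fst k))"
  have "fock_form d (\<lambda>z. p (?A *v z)) (\<lambda>z. q (?A *v z)) = fock_form d p q"
    unfolding fock_form_def
    by (intro sum.cong refl polar_unitary maxU_inverse_unitary assms)
  then show ?thesis
    using assms by (simp add: fock_gact_def[abs_def] fock_form_scale_left fock_form_scale_right
        fock_subst fock_scale mult.assoc)
qed

lemma linear_fock_gact:
  "Vector_Spaces.linear (\<lambda>c p z. c * p z) (\<lambda>c p z. c * p z) (fock_gact k)"
  unfolding Vector_Spaces.linear_iff
  by (simp add: fock_vs.vector_space_axioms fock_gact_def[abs_def] fun_eq_iff distrib_left mult.left_commute)

text \<open>Independent sets of polynomials of bounded degree are finite, as they are bounded in
  size by the finitely many monomials.\<close>

lemma polyp_subspace_basis: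
  fixes N :: "(complex ^ 'n::finite \<Rightarrow> complex) set"
  assumes N: "fock_vs.subspace N" "\<And>n. n \<in> N \<Longrightarrow> polyp d n"
  obtains B where "finite B" "B \<subseteq> N" "fock_vs.independent B" "fock_vs.span B = N"
proof -
  obtain M :: "(complex ^ 'n \<Rightarrow> complex) set"
    where M: "finite M" "\<forall>p. polyp d p \<longrightarrow> p \<in> fock_vs.span M"
    using polyp_finitely_spanned[of d] by blast
  obtain B where B: "B \<subseteq> N" "fock_vs.independent B" "N \<subseteq> fock_vs.span B"
    by (rule fock_vs.basis_exists)
  have "B \<subseteq> fock_vs.span M" using B(1) M(2) N(2) by auto
  then have "finite B"
    using fock_vs.independent_span_bound[OF M(1) B(2)] by simp
  moreover have "fock_vs.span B = N"
    using B(3) fock_vs.span_minimal[OF B(1) N(1)] by simp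
  ultimately show ?thesis using that B by simp
qed

text \<open>As \<open>k\<close> is injective on the finite-dimensional \<open>N\<close>, it maps \<open>N\<close> onto itself.  Hence no inverse
  of \<open>k\<close> in the metaplectic group is needed.\<close>

lemma orthogonal_complement_invariant:
  fixes N :: "(complex ^ 'n::finite \<Rightarrow> complex) set"
  assumes N: "fock_vs.subspace N" "\<And>n. n \<in> N \<Longrightarrow> polyp d n" "fock_gact k ` N \<subseteq> N"
    and k: "fst k \<in> maxU"
    and p: "p \<in> vecs fock" "\<And>n. n \<in> N \<Longrightarrow> fock_form d p n = 0"
    and n: "n \<in> N"
  shows "fock_form d (fock_gact k p) n = 0"
proof (cases "snd k (mat \<i>) = 0")
  \<comment> \<open>The assumption on \<open>k\<close> places it over \<open>maxU\<close> but not in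
    \<open>Mp\<close>, so its branch value could be 0; the operator is then zero.\<close>
  case True
  then have "fock_gact k p = (\<lambda>z. 0)" by (simp add: fock_gact_def[abs_def])
  then show ?thesis by (simp add: fock_form_zero_left)
next
  case False
  interpret g: Vector_Spaces.linear "\<lambda>c p z. c * p z" "\<lambda>c p z. c * p z" "fock_gact k"
    by (rule linear_fock_gact)
  obtain B where B: "finite B" "B \<subseteq> N" "fock_vs.independent B" and span_B: "fock_vs.span B = N"
    by (rule polyp_subspace_basis[OF N(1,2)])
  have inj: "inj_on (fock_gact k) (fock_vs.span B)"
  proof (rule g.inj_on_iff_eq_0[THEN iffD2])
    show "fock_vs.subspace (fock_vs.span B)" by simp
    show "\<forall>q\<in>fock_vs.span B. fock_gact k q = 0 \<longrightarrow> q = 0"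
    proof (intro ballI impI)
      fix q assume q: "q \<in> fock_vs.span B" "fock_gact k q = 0"
      have "polyp d q" using q N(2) span_B by blast
      moreover have "fock_form d q q = 0"
        using fock_form_gact[OF k polyp_fock[OF calculation] polyp_fock[OF calculation], of d] q(2) False
        by (simp add: zero_fun_def fock_form_zero_left)
      ultimately show "q = 0" by (rule fock_form_definite)
    qed
  qed
  have indep: "fock_vs.independent (fock_gact k ` B)"
    by (rule g.independent_injective_image[OF B(3) inj])
  have card: "card (fock_gact k ` B) = card B"
    by (intro card_image inj_on_subset[OF inj] fock_vs.span_superset)
  have "B \<subseteq> fock_vs.span (fock_gact k ` B)"
  proof (rule ccontr)
    assume "\<not> ?thesis"
    then obtain b where b: "b \<in> B" "b \<notin> fock_vs.span (fock_gact k ` B)" by blast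
    \<comment> \<open>Dimension count: otherwise \<open>card B + 1\<close> independent vectors would
      lie in the span of \<open>B\<close>.\<close>
    have "fock_vs.independent (insert b (fock_gact k ` B))"
      using indep b by (simp add: fock_vs.independent_insert)
    moreover have "insert b (fock_gact k ` B) \<subseteq> fock_vs.span B"
      using b(1) B(2) N(3) span_B by blast
    ultimately have "card (insert b (fock_gact k ` B)) \<le> card B"
      using fock_vs.independent_span_bound[OF B(1)] by blast
    moreover have "b \<notin> fock_gact k ` B" using b fock_vs.span_base by blast
    ultimately show False using B(1) card by simp
  qed
  then have "fock_vs.span B \<subseteq> fock_vs.span (fock_gact k ` B)"
    by (simp add: fock_vs.span_minimal)
  then have "N \<subseteq> fock_gact k ` N"
    using g.span_image[of B] span_B by simp
  then obtain m where m: "m \<in> N" "n = fock_gact k m" using n by blast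
  show ?thesis
    using fock_form_gact[OF k p(1) polyp_fock[OF N(2)[OF m(1)]], of d] p(2)[OF m(1)]
    by (simp add: m(2))
qed

section \<open>Lifting K-types from a quotient to the Fock space\<close>

lemma linear_on_zero:
  assumes "linear_on M s T" "module.subspace (scl M) (vecs M)" "vector_space (scl M)" "vector_space s"
  shows "T 0 = 0"
proof -
  interpret M: vector_space "scl M" by fact
  interpret s: vector_space s by fact
  have "T (scl M 0 0) = s 0 (T 0)"
    using assms M.subspace_0 unfolding linear_on_def by blast
  then show ?thesis by simp
qed

lemma linear_on_diff:
  assumes "linear_on M s T" "module.subspace (scl M) (vecs M)" "vector_space (scl M)" "vector_space s"
    and "x \<in> vecs M" "y \<in> vecs M"
  shows "T (x - y) = T x - T y"
proof -
  interpret M: vector_space "scl M" by fact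
  have "T ((x - y) + y) = T (x - y) + T y"
    using assms M.subspace_diff unfolding linear_on_def by blast
  then show ?thesis by (simp add: eq_diff_eq)
qed

lemma K_moduleD:
  assumes "K_module K M"
  shows "vector_space (scl M)" "module.subspace (scl M) (vecs M)"
    "\<And>k. k \<in> K \<Longrightarrow> linear_on M (scl M) (gact M k)"
    "\<And>k v. k \<in> K \<Longrightarrow> v \<in> vecs M \<Longrightarrow> gact M k v \<in> vecs M"
  using assms unfolding K_module_def by blast+

text \<open>In bounded degree, \<open>T\<close> is injective on the orthogonal complement
  \<open>C\<close> of its kernel \<open>N\<close>. Inverting \<open>T\<close> on \<open>C\<close>
  turns an embedding of \<sigma> into \<pi> into one into the Fock space.\<close>

lemma Ktype_lifts_to_fock:
  fixes \<pi> :: "('n::finite mp, 'v::ab_group_add, 'z) kmod_scheme"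
    and \<sigma> :: "('n, 's::ab_group_add) kmodule"
  assumes \<pi>: "K_module K \<pi>" and K: "\<And>k. k \<in> K \<Longrightarrow> fst k \<in> maxU"
    and T: "T \<in> Hom_K K fock \<pi>" "T ` vecs fock = vecs \<pi>"
    and \<sigma>: "\<sigma> \<in> Ktypes_in K \<pi>"
  shows "\<sigma> \<in> Ktypes_in K fock"
proof -
  obtain \<tau> v0 where \<tau>: "\<tau> \<in> Hom_K K \<sigma> \<pi>" and v0: "v0 \<in> vecs \<sigma>" "\<tau> v0 \<noteq> 0"
    and type: "is_Ktype K \<sigma>"
    using \<sigma> unfolding Ktypes_in_def by blast
  have \<sigma>K: "K_module K \<sigma>" using type unfolding is_Ktype_def by blast
  interpret s: vector_space "scl \<sigma>" using K_moduleD[OF \<sigma>K] by blast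
  interpret p: vector_space "scl \<pi>" using K_moduleD[OF \<pi>] by blast
  have T_lin: "linear_on fock (scl \<pi>) T" and
    T_k: "\<And>k q. k \<in> K \<Longrightarrow> q \<in> vecs fock \<Longrightarrow> T (fock_gact k q) = gact \<pi> k (T q)"
    using T(1) by (simp_all add: Hom_K_def)
  have T_add: "T (\<lambda>z. q z + r z) = T q + T r" if "q \<in> vecs fock" "r \<in> vecs fock" for q r
    using T_lin that unfolding linear_on_def by (simp add: plus_fun_def)
  have T_scl: "T (\<lambda>z. c * q z) = scl \<pi> c (T q)" if "q \<in> vecs fock" for q c
    using T_lin that unfolding linear_on_def by simp
  have \<tau>_lin: "linear_on \<sigma> (scl \<pi>) \<tau>" and \<tau>_vecs: "\<And>v. v \<in> vecs \<sigma> \<Longrightarrow> \<tau> v \<in> vecs \<pi>"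
    and \<tau>_k: "\<And>k v. k \<in> K \<Longrightarrow> v \<in> vecs \<sigma> \<Longrightarrow> \<tau> (gact \<sigma> k v) = gact \<pi> k (\<tau> v)"
    using \<tau> by (auto simp: Hom_K_def)
  have T_diff: "T (\<lambda>z. q z - r z) = T q - T r" if "q \<in> vecs fock" "r \<in> vecs fock" for q r
    using linear_on_diff[OF T_lin _ _ _ that] subspace_fock fock_vs.vector_space_axioms
      p.vector_space_axioms
    by (simp add: fun_diff_def)
  have T_0: "T (\<lambda>z. 0) = 0"
    using linear_on_zero[OF T_lin] subspace_fock fock_vs.vector_space_axioms p.vector_space_axioms
    by (simp add: zero_fun_def)
  have \<tau>_0: "\<tau> 0 = 0"
    using linear_on_zero[OF \<tau>_lin] K_moduleD[OF \<sigma>K] p.vector_space_axioms by blast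
  obtain q0 where "q0 \<in> vecs fock" "T q0 = \<tau> v0"
    using T(2) \<tau>_vecs[OF v0(1)] by (metis imageE)
  \<comment> \<open>A degree bound for a preimage of the single vector \<open>\<tau> v0\<close>
    suffices, because irreducibility spreads the lift to all of \<sigma>.\<close>
  then obtain d where q0: "polyp d q0" "T q0 = \<tau> v0" by (auto simp: vecs_fock_iff)
  define N where "N = {q. polyp d q \<and> T q = 0}"
  define C where "C = {q. polyp d q \<and> (\<forall>n\<in>N. fock_form d q n = 0)}"
  have N: "fock_vs.subspace N"
    using T_0 T_add T_scl
    by (auto simp: N_def fock_vs.subspace_def zero_fun_def plus_fun_def polyp_fock
        intro: polyp.const polyp.add polyp_scale)
  have N_k: "fock_gact k ` N \<subseteq> N" if "k \<in> K" for k
  proof -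
    have "gact \<pi> k 0 = 0"
      using linear_on_zero[OF K_moduleD(3)[OF \<pi> that]] K_moduleD[OF \<pi>] by blast
    then show ?thesis by (auto simp: N_def polyp_fock_gact T_k[OF that] polyp_fock)
  qed
  have C_fock: "q \<in> vecs fock" if "q \<in> C" for q
    using that by (auto simp: C_def polyp_fock)
  have C_add: "(\<lambda>z. q z + r z) \<in> C" if "q \<in> C" "r \<in> C" for q r
    using that C_fock by (auto simp: C_def fock_form_add_left intro: polyp.add)
  have C_scale: "(\<lambda>z. c * q z) \<in> C" if "q \<in> C" for q c
    using that C_fock by (auto simp: C_def fock_form_scale_left intro: polyp_scale)
  have C_k: "fock_gact k q \<in> C" if "k \<in> K" "q \<in> C" for k q
  proof -
    have q: "polyp d q" "\<And>n. n \<in> N \<Longrightarrow> fock_form d q n = 0" using that by (auto simp: C_def)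
    have "fock_form d (fock_gact k q) n = 0" if "n \<in> N" for n
    proof (rule orthogonal_complement_invariant[OF N _ N_k K _ q(2) that])
      show "polyp d m" if "m \<in> N" for m using that by (simp add: N_def)
    qed (use \<open>k \<in> K\<close> \<open>q \<in> C\<close> C_fock in auto)
    then show ?thesis using polyp_fock_gact[OF q(1)] by (simp add: C_def)
  qed
  have C_unique: "q = r" if "q \<in> C" "r \<in> C" "T q = T r" for q r
  proof -
    have m: "(\<lambda>z. q z - r z) \<in> C"
      using C_add[OF that(1) C_scale[OF that(2), of "-1"]] by simp
    have "T (\<lambda>z. q z - r z) = 0"
      using that C_fock by (simp add: T_diff)
    then have "(\<lambda>z. q z - r z) \<in> N"
      using m by (simp add: N_def C_def)
    then have "(\<lambda>z. q z - r z) = 0"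
      using m by (intro fock_form_definite[of d]) (auto simp: C_def)
    then show ?thesis by (simp add: fun_eq_iff)
  qed
  \<comment> \<open>These are the vectors that can be lifted to \<open>C\<close>. They form an
    invariant subspace containing \<open>v0\<close>, hence all of \<sigma>.\<close>
  define S where "S = {v \<in> vecs \<sigma>. \<exists>q\<in>C. T q = \<tau> v}"
  have "(\<lambda>z. 0) \<in> C" by (auto simp: C_def fock_form_zero_left intro: polyp.const)
  then have "0 \<in> S"
    using T_0 \<tau>_0 s.subspace_0[OF K_moduleD(2)[OF \<sigma>K]] by (auto simp: S_def)
  moreover have "x + y \<in> S" if xy: "x \<in> S" "y \<in> S" for x y
  proof -
    from xy obtain q r where qr: "q \<in> C" "r \<in> C" "T q = \<tau> x" "T r = \<tau> y" by (auto simp: S_def)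
    then have "T (\<lambda>z. q z + r z) = \<tau> (x + y)"
      using xy \<tau>_lin C_fock by (simp add: T_add S_def linear_on_def)
    then show ?thesis
      using C_add[OF qr(1,2)] xy s.subspace_add[OF K_moduleD(2)[OF \<sigma>K]] by (auto simp: S_def)
  qed
  moreover have "scl \<sigma> c x \<in> S" if x: "x \<in> S" for c x
  proof -
    from x obtain q where q: "q \<in> C" "T q = \<tau> x" by (auto simp: S_def)
    then have "T (\<lambda>z. c * q z) = \<tau> (scl \<sigma> c x)"
      using x \<tau>_lin C_fock by (simp add: T_scl S_def linear_on_def)
    then show ?thesis
      using C_scale[OF q(1)] x s.subspace_scale[OF K_moduleD(2)[OF \<sigma>K]] by (auto simp: S_def)
  qed
  ultimately have "s.subspace S" by (simp add: s.subspace_def)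
  moreover have "gact \<sigma> k ` S \<subseteq> S" if k: "k \<in> K" for k
  proof
    fix y assume "y \<in> gact \<sigma> k ` S"
    then obtain x q where x: "y = gact \<sigma> k x" "x \<in> vecs \<sigma>" "q \<in> C" "T q = \<tau> x" by (auto simp: S_def)
    then have "T (fock_gact k q) = \<tau> y" using k C_fock by (simp add: T_k \<tau>_k)
    then show "y \<in> S"
      using C_k[OF k x(3)] K_moduleD(4)[OF \<sigma>K k x(2)] x(1) by (auto simp: S_def)
  qed
  moreover have "v0 \<in> S"
  proof -
    \<comment> \<open>Subtracting from \<open>q0\<close> its projection to \<open>N\<close> moves it
      into \<open>C\<close> without changing its image under \<open>T\<close>.\<close>
    obtain B where B: "finite B" "B \<subseteq> N" and span_B: "fock_vs.span B = N"
    proof (rule polyp_subspace_basis[OF N])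
      show "polyp d n" if "n \<in> N" for n using that by (simp add: N_def)
    qed
    have "polyp d b" if "b \<in> B" for b using that B(2) by (auto simp: N_def)
    from fock_projection[OF B(1) this q0(1)] obtain n where n: "n \<in> N" "polyp d n"
      "\<forall>s\<in>N. fock_form d (\<lambda>z. q0 z - n z) s = 0"
      unfolding span_B by blast
    then have "T (\<lambda>z. q0 z - n z) = \<tau> v0"
      using q0(2) n(1) by (simp add: T_diff polyp_fock[OF q0(1)] polyp_fock[OF n(2)] N_def)
    moreover have "(\<lambda>z. q0 z - n z) \<in> C"
      using n q0(1) by (auto simp: C_def intro: polyp_diff)
    ultimately show ?thesis using v0(1) by (auto simp: S_def)
  qed
  moreover have "v0 \<noteq> 0" using v0(2) \<tau>_0 by auto
  moreover have "S \<subseteq> vecs \<sigma>" by (auto simp: S_def)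
  ultimately have S: "S = vecs \<sigma>"
    using type unfolding is_Ktype_def by blast
  \<comment> \<open>Uniqueness of lifts in \<open>C\<close> justifies the description and also
    yields linearity and equivariance of \<rho>.\<close>
  define \<rho> where "\<rho> v = (THE q. q \<in> C \<and> T q = \<tau> v)" for v
  have \<rho>: "\<rho> v \<in> C" "T (\<rho> v) = \<tau> v" if v: "v \<in> vecs \<sigma>" for v
  proof -
    have "\<exists>!q. q \<in> C \<and> T q = \<tau> v"
      using v S C_unique by (auto simp: S_def)
    from theI'[OF this] show "\<rho> v \<in> C" "T (\<rho> v) = \<tau> v" by (auto simp: \<rho>_def)
  qed
  have \<rho>_eqI: "\<rho> v = q" if "v \<in> vecs \<sigma>" "q \<in> C" "T q = \<tau> v" for v q
    using that \<rho> by (intro C_unique) auto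
  have "\<rho> \<in> Hom_K K \<sigma> fock"
    unfolding Hom_K_def linear_on_def
  proof (intro CollectI conjI ballI allI)
    fix x y assume xy: "x \<in> vecs \<sigma>" "y \<in> vecs \<sigma>"
    then show "\<rho> (x + y) = \<rho> x + \<rho> y"
      using \<tau>_lin \<rho> C_fock C_add s.subspace_add[OF K_moduleD(2)[OF \<sigma>K]]
      by (intro \<rho>_eqI) (auto simp: plus_fun_def T_add linear_on_def)
  next
    fix c x assume "x \<in> vecs \<sigma>"
    then show "\<rho> (scl \<sigma> c x) = scl fock c (\<rho> x)"
      using \<tau>_lin \<rho> C_fock C_scale s.subspace_scale[OF K_moduleD(2)[OF \<sigma>K]]
      by (intro \<rho>_eqI) (auto simp: T_scl linear_on_def)
  next
    fix k x assume "k \<in> K" "x \<in> vecs \<sigma>"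
    then show "\<rho> (gact \<sigma> k x) = gact fock k (\<rho> x)"
      using \<rho> C_fock C_k K_moduleD(4)[OF \<sigma>K]
      by (intro \<rho>_eqI) (auto simp: T_k \<tau>_k)
  qed (use \<rho> C_fock in auto)
  moreover have "\<rho> v0 \<noteq> 0"
    using \<rho>(2)[OF v0(1)] v0(2) T_0 by (auto simp: zero_fun_def)
  ultimately show ?thesis
    using type v0(1) unfolding Ktypes_in_def by blast
qed

section \<open>Parity of polynomials and of the operators\<close>

lemma matrix_vector_mult_minus:
  fixes A :: "'a::ring_1 ^ 'n ^ 'm"
  shows "(- A) *v x = - (A *v x)" "A *v (- x) = - (A *v x)"
  by (simp_all add: matrix_vector_mult_def vec_eq_iff sum_negf)

lemma matrix_mult_minus:
  fixes A :: "'a::ring_1 ^ 'n ^ 'm" and B :: "'a ^ 'k ^ 'n"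
  shows "(- A) ** B = - (A ** B)" "A ** (- B) = - (A ** B)"
  by (simp_all add: matrix_matrix_mult_def vec_eq_iff sum_negf)

lemma transpose_minus_one: "transpose (- mat 1) = (- mat 1 :: 'a::ring_1 ^ 'n ^ 'n)"
  by (simp add: transpose_def mat_def vec_eq_iff)

definition parity_space :: "complex \<Rightarrow> (complex ^ 'n::finite \<Rightarrow> complex) set" where
  "parity_space \<epsilon> = {p \<in> vecs fock. \<forall>z. p (- z) = \<epsilon> * p z}"

lemma subspace_parity: "fock_vs.subspace (parity_space \<epsilon>)"
  by (auto simp: fock_vs.subspace_def parity_space_def zero_fun_def plus_fun_def distrib_left
      mult.left_commute intro: fock_const fock_add fock_scale)

text \<open>The homogeneous part of degree \<open>d\<close> has parity \<open>(-1) ^ d\<close> and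
  cancels. This form avoids splitting into homogeneous components.\<close>

lemma polyp_parity_defect:
  "polyp d p \<Longrightarrow> polyp (d - 1) (\<lambda>z. p z - (-1) ^ d * p (- z))"
proof (induction rule: polyp.induct)
  case (const d c)
  show ?case by (rule polyp.const)
next
  case (mult d p i)
  have eq: "z $ i * p z - (-1) ^ Suc d * ((- z) $ i * p (- z)) = z $ i * (p z - (-1) ^ d * p (- z))" for z
    by (simp add: algebra_simps)
  have "polyp d (\<lambda>z. z $ i * (p z - (-1) ^ d * p (- z)))"
  proof (cases d)
    case 0
    with polyp_0[OF mult.hyps] show ?thesis by (auto intro: polyp.const)
  next
    case (Suc e)
    then show ?thesis using polyp.mult[of e] mult.IH by simp
  qed
  then show ?case unfolding eq by simp
next
  case (add d p q)
  have eq: "p z + q z - (-1) ^ d * (p (- z) + q (- z)) =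
      (p z - (-1) ^ d * p (- z)) + (q z - (-1) ^ d * q (- z))" for z
    by (simp add: algebra_simps)
  show ?case unfolding eq by (rule polyp.add[OF add.IH])
qed

text \<open>If the parity were opposite to that of the degree, the defect would be 2p, and its
  smaller degree bound would contradict the minimality of the degree.\<close>

lemma poly_degree_parity:
  assumes p: "p \<in> parity_space \<epsilon>" "p \<noteq> 0" and \<epsilon>: "\<epsilon> = 1 \<or> \<epsilon> = -1"
  shows "(-1) ^ poly_degree p = \<epsilon>"
proof (rule ccontr)
  let ?d = "poly_degree p"
  assume "(-1) ^ ?d \<noteq> \<epsilon>"
  then have \<epsilon>': "\<epsilon> = - ((-1) ^ ?d)"
    using \<epsilon> by (cases "even ?d") auto
  have "\<exists>d. p \<in> poly_deg_le d"
    using p(1) by (auto simp: parity_space_def vecs_fock_iff poly_deg_le_iff)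
  then have d: "polyp ?d p"
    unfolding poly_degree_def poly_deg_le_iff[symmetric] by (rule LeastI_ex)
  have eq: "p z - (-1) ^ ?d * p (- z) = 2 * p z" for z
    using p(1) by (simp add: parity_space_def \<epsilon>')
  have low: "polyp (?d - 1) (\<lambda>z. 2 * p z)"
    using polyp_parity_defect[OF d] unfolding eq .
  have "polyp (?d - 1) p" using polyp_scale[OF low, of "1 / 2"] by simp
  then have "?d \<le> ?d - 1"
    unfolding poly_degree_def poly_deg_le_iff[symmetric] by (rule Least_le)
  \<comment> \<open>Truncated subtraction leaves degree 0 without a contradiction; there
    \<open>p\<close> is constant, and p(z) - p(-z) = 2 p(z) forces it to be 0.\<close>
  then have "?d = 0" by simp
  then obtain c where "p = (\<lambda>z. c)" using polyp_0[OF d] by blast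
  then have "p z = 0" for z using eq[of z] \<open>?d = 0\<close> by simp
  then show False using p(2) by (auto simp: fun_eq_iff)
qed

lemma parity_decomposition:
  assumes "p \<in> vecs fock"
  obtains q r where "q \<in> parity_space 1" "r \<in> parity_space (- 1)" "p = q + r"
proof
  have "(\<lambda>z. p (- z)) \<in> vecs fock"
    using fock_subst[OF assms, of "- mat 1"] by (simp add: matrix_vector_mult_minus)
  then have "(\<lambda>z. (1/2) * (p z + p (- z))) \<in> vecs fock" "(\<lambda>z. (1/2) * (p z - p (- z))) \<in> vecs fock"
    using assms fock_scale[of _ "1/2"] fock_add fock_diff by blast+
  then show "(\<lambda>z. (1/2) * (p z + p (- z))) \<in> parity_space 1"
    and "(\<lambda>z. (1/2) * (p z - p (- z))) \<in> parity_space (- 1)"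
    by (simp_all add: parity_space_def field_simps)
  show "p = (\<lambda>z. (1/2) * (p z + p (- z))) + (\<lambda>z. (1/2) * (p z - p (- z)))"
    by (simp add: fun_eq_iff field_simps)
qed

text \<open>The chain rule for the substitution of -z contributes the extra sign.\<close>

lemma parity_partial_deriv:
  assumes "p \<in> parity_space \<epsilon>"
  shows "partial_deriv j p \<in> parity_space (- \<epsilon>)"
proof -
  have p: "p \<in> vecs fock" and eq: "(\<lambda>z. p (- z)) = (\<lambda>z. \<epsilon> * p z)"
    using assms by (auto simp: parity_space_def)
  have "partial_deriv j (\<lambda>z. p (- z)) = (\<lambda>z. - partial_deriv j p (- z))"
  proof -
    have "(\<Sum>i\<in>UNIV. (- mat 1 :: complex ^ 'a ^ 'a) $ i $ j * partial_deriv i p w) = - partial_deriv j p w" for w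
      by (simp add: mat_def if_distrib[of "\<lambda>x. - x"] if_distrib[of "\<lambda>x. x * _"] cong: if_cong)
    then show ?thesis
      using partial_deriv_subst[OF p, of j "- mat 1"] by (simp add: matrix_vector_mult_minus)
  qed
  moreover have "partial_deriv j (\<lambda>z. p (- z)) = (\<lambda>z. \<epsilon> * partial_deriv j p z)"
    unfolding eq by (rule partial_deriv_scale[OF p])
  ultimately have "- partial_deriv j p (- z) = \<epsilon> * partial_deriv j p z" for z
    by (metis (no_types))
  then have "partial_deriv j p (- z) = - \<epsilon> * partial_deriv j p z" for z
    by (metis minus_equation_iff mult_minus_left)
  then show ?thesis using p by (simp add: parity_space_def fock_partial_deriv)
qed

lemma fock_lact_in_fock:
  assumes "p \<in> vecs fock"
  shows "fock_lact X p \<in> vecs fock"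
proof -
  have "fock_lact X p = (\<lambda>z. ((\<Sum>j\<in>UNIV. \<Sum>k\<in>UNIV. - cl_P X $ j $ k * (z $ k * partial_deriv j p z))
      + - (\<Sum>j\<in>UNIV. cl_P X $ j $ j) / 2 * p z)
      + ((\<Sum>j\<in>UNIV. \<Sum>k\<in>UNIV. cl_R X $ j $ k / 2 * (z $ j * (z $ k * p z)))
      + (\<Sum>j\<in>UNIV. \<Sum>k\<in>UNIV. - cl_Q X $ j $ k / 2 * partial_deriv j (partial_deriv k p) z)))"
    by (simp add: fock_lact_def fun_eq_iff sum_negf sum_distrib_left sum_distrib_right
        sum_divide_distrib mult.assoc)
  also have "\<dots> \<in> vecs fock"
    by (intro fock_add fock_sum fock_scale fock_coord_mult fock_partial_deriv assms)
  finally show ?thesis .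
qed

text \<open>Apart from the scalar term, \<open>fock_lact X\<close> is quadratic in coordinates and
  derivatives, and each of the two factors reverses the parity.\<close>

lemma parity_lact:
  assumes "p \<in> parity_space \<epsilon>"
  shows "fock_lact X p \<in> parity_space \<epsilon>"
proof -
  have p: "p \<in> vecs fock" "\<And>z. p (- z) = \<epsilon> * p z"
    using assms by (auto simp: parity_space_def)
  have d: "partial_deriv j p (- z) = - \<epsilon> * partial_deriv j p z" for j z
    using parity_partial_deriv[OF assms] by (simp add: parity_space_def)
  have dd: "partial_deriv i (partial_deriv j p) (- z) = \<epsilon> * partial_deriv i (partial_deriv j p) z" for i j z
    using parity_partial_deriv[OF parity_partial_deriv[OF assms]] by (simp add: parity_space_def)
  have "fock_lact X p (- z) = \<epsilon> * fock_lact X p z" for z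
    by (simp add: fock_lact_def p(2) d dd algebra_simps sum_distrib_left)
  then show ?thesis using p by (simp add: parity_space_def fock_lact_in_fock)
qed

lemma parity_gact: "p \<in> parity_space \<epsilon> \<Longrightarrow> fock_gact k p \<in> parity_space \<epsilon>"
  by (auto simp: parity_space_def fock_gact_in_fock) (simp add: fock_gact_def matrix_vector_mult_minus)

section \<open>The lift of -1 to the metaplectic group\<close>

text \<open>The determinant of the automorphy factor of -1 is the constant (-1)^N, so a constant
  branch of its square root exists; i^N is one of the two choices.\<close>

definition minus_one_lift :: "'n::finite mp" where
  "minus_one_lift = (- mat 1, \<lambda>Z. if Z \<in> siegel then \<i> ^ CARD('n) else 0)"

text \<open>The action on the Fock space evaluates the branch at this point, which must lie where
  the branch is not set to 0.\<close>

lemma i_in_siegel: "mat \<i> \<in> (siegel :: (complex ^ 'n ^ 'n::finite) set)"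
proof -
  have "0 < (\<Sum>i\<in>UNIV. \<Sum>j\<in>UNIV. Im ((mat \<i> :: complex ^ 'n ^ 'n) $ i $ j) * x $ i * x $ j)"
    if "x \<noteq> 0" for x :: "real ^ 'n"
  proof -
    have "(\<Sum>i\<in>UNIV. \<Sum>j\<in>UNIV. Im ((mat \<i> :: complex ^ 'n ^ 'n) $ i $ j) * x $ i * x $ j) = x \<bullet> x"
      by (simp add: mat_def inner_vec_def if_distrib[of Im] if_distrib[of "\<lambda>x. x * _"] cong: if_cong)
    then show ?thesis using that by simp
  qed
  then show ?thesis by (simp add: siegel_def transpose_mat)
qed

lemma fock_gact_minus_one: "fock_gact minus_one_lift p = (\<lambda>z. inverse (\<i> ^ CARD('n)) * p (- z))"
  for p :: "complex ^ 'n::finite \<Rightarrow> complex"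
proof -
  have "unitary_of (- mat 1 :: 'n rmat) = - mat 1"
    by (simp add: unitary_of_def blkA_def blkC_def mat_def vec_eq_iff complex_eq_iff)
  moreover have "matrix_inv (- mat 1 :: complex ^ 'n ^ 'n) = - mat 1"
    by (rule matrix_inv_eqI) (simp_all add: matrix_mult_minus)
  ultimately show ?thesis
    by (simp add: fock_gact_def[abs_def] minus_one_lift_def i_in_siegel matrix_vector_mult_minus)
qed

text \<open>The scalar matrix -1 commutes with everything, so every centralizer in \<open>Sp\<close>
  contains it. This is how the dual pair enters the parity argument.\<close>

lemma minus_one_lift_in_coverK:
  fixes G :: "'n::finite rmat set"
  assumes "G = centralizer_Sp E"
  shows "minus_one_lift \<in> coverK G"
proof -
  have Sp: "- mat 1 \<in> (Sp :: 'n rmat set)"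
    by (simp add: Sp_def matrix_mult_minus transpose_minus_one)
  then have "- mat 1 \<in> G"
    using assms by (simp add: centralizer_Sp_def matrix_mult_minus)
  moreover have "- mat 1 \<in> (maxU :: 'n rmat set)"
    using Sp by (simp add: maxU_def orthogonal_matrix transpose_minus_one
        matrix_mult_minus)
  moreover have "minus_one_lift \<in> (Mp :: 'n mp set)"
  proof -
    have aut: "aut_factor (- mat 1 :: 'n rmat) Z = - mat 1" for Z
      by (simp add: aut_factor_def blkC_def blkD_def complexify_def map_matrix_def mat_def
          matrix_matrix_mult_def vec_eq_iff)
    have "det (- mat 1 :: complex ^ 'n ^ 'n) = (- 1) ^ CARD('n)"
      by (subst det_diagonal) (simp_all add: mat_def)
    moreover have "(\<i> ^ CARD('n))\<^sup>2 = (- 1) ^ CARD('n)"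
      by (metis power_mult mult.commute power2_i)
    moreover have "continuous_on siegel (\<lambda>Z :: complex ^ 'n ^ 'n. if Z \<in> siegel then \<i> ^ CARD('n) else 0)"
      by (subst continuous_on_cong[OF refl, where g = "\<lambda>_. \<i> ^ CARD('n)"]) simp_all
    ultimately show ?thesis
      using Sp by (simp add: Mp_def minus_one_lift_def aut)
  qed
  ultimately show ?thesis by (simp add: coverK_def cover_def minus_one_lift_def)
qed

section \<open>From a non-zero theta lift to a non-zero equivariant map\<close>

lemma functional_nonzero:
  assumes "vector_space (scl M)" "v \<noteq> 0"
  shows "\<exists>f. functional_on M f \<and> f v \<noteq> 0"
proof -
  interpret M: vector_space "scl M" by fact
  interpret C: vector_space "(*) :: complex \<Rightarrow> complex \<Rightarrow> complex"
    by unfold_locales (simp_all add: algebra_simps)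
  interpret P: vector_space_pair "scl M" "(*) :: complex \<Rightarrow> complex \<Rightarrow> complex" ..
  obtain f where "Vector_Spaces.linear (scl M) (*) f" "f v = (1 :: complex)"
    using P.linear_independent_extend[of "{v}" "\<lambda>_. 1"] assms(2) by auto
  then show ?thesis
    by (intro exI[of _ f]) (auto simp: functional_on_def linear_on_def Vector_Spaces.linear_iff)
qed

text \<open>Tensors are functions on bilinear forms, so a non-zero one is exhibited by a form on
  which it does not vanish: the product of functionals non-zero at \<open>v\<close> and at
  \<open>w\<close>.\<close>

lemma tensor_space_nonzero:
  assumes "vector_space (scl M)" "vector_space (scl N)"
    and "v \<in> vecs M" "v \<noteq> 0" "w \<in> vecs N" "w \<noteq> 0"
  shows "\<exists>t\<in>tensor_space M N. t \<noteq> 0"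
proof
  obtain f where f: "functional_on M f" "f v \<noteq> 0" using functional_nonzero assms by blast
  obtain g where g: "functional_on N g" "g w \<noteq> 0" using functional_nonzero assms by blast
  have "(\<lambda>x y. f x * g y) \<in> bilinear_forms M N"
    using f(1) g(1) by (simp add: bilinear_forms_def functional_on_def linear_on_def algebra_simps)
  then have "pure_tensor M N v w (\<lambda>x y. f x * g y) \<noteq> 0"
    using f g by (simp add: pure_tensor_def)
  then show "pure_tensor M N v w \<noteq> 0" by (metis zero_fun_apply)
  show "pure_tensor M N v w \<in> tensor_space M N"
    using assms unfolding tensor_space_def by (auto intro!: fock_vs.span_base)
qed

text \<open>A non-zero \<theta> forces \<Theta> to be non-zero, hence also \<pi> \<otimes> \<Theta>.
  The Fock space maps onto it with kernel \<open>howe_kernel\<close>, so some polynomial escapes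
  that kernel.\<close>

lemma theta_lift_hom:
  assumes \<pi>: "irreducible_gK_module G \<pi>" and lift: "is_theta_lift G G' \<pi> \<Theta> \<theta>" and "vecs \<theta> \<noteq> {0}"
  shows "\<exists>T\<in>Hom_gK G fock \<pi>. \<exists>p\<in>vecs fock. T p \<noteq> 0"
proof -
  have big: "is_big_theta G G' \<pi> \<Theta>" and "vecs \<Theta> \<noteq> {0}"
    using lift assms(3) by (auto simp: is_theta_lift_def split: if_splits)
  then obtain \<Phi> where \<Theta>: "gK_module G' \<Theta>" and \<Phi>: "\<Phi> ` vecs fock = tensor_space \<pi> \<Theta>"
    "{p \<in> vecs fock. \<Phi> p = 0} = howe_kernel G \<pi>"
    unfolding is_big_theta_def by blast
  have K\<pi>: "K_module (coverK G) \<pi>" and K\<Theta>: "K_module (coverK G') \<Theta>" and "vecs \<pi> \<noteq> {0}"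
    using \<pi> \<Theta> by (auto simp: irreducible_gK_module_def gK_module_def)
  have nz: "\<exists>v\<in>vecs M. v \<noteq> 0" if "K_module K M" "vecs M \<noteq> {0}"
    for K and M :: "('k::finite mp, 'y::ab_group_add, 'z) kmod_scheme"
  proof -
    interpret vector_space "scl M" using K_moduleD[OF that(1)] by blast
    show ?thesis using subspace_0[OF K_moduleD(2)[OF that(1)]] that(2) by blast
  qed
  obtain v where "v \<in> vecs \<pi>" "v \<noteq> 0" using nz[OF K\<pi> \<open>vecs \<pi> \<noteq> {0}\<close>] by blast
  moreover obtain w where "w \<in> vecs \<Theta>" "w \<noteq> 0" using nz[OF K\<Theta> \<open>vecs \<Theta> \<noteq> {0}\<close>] by blast
  ultimately obtain t where t: "t \<in> tensor_space \<pi> \<Theta>" "t \<noteq> 0"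
    using tensor_space_nonzero[OF K_moduleD(1)[OF K\<pi>] K_moduleD(1)[OF K\<Theta>]] by blast
  then obtain p where "p \<in> vecs fock" "\<Phi> p \<noteq> 0" using \<Phi>(1) by (metis imageE)
  then have "p \<in> vecs fock" "p \<notin> howe_kernel G \<pi>" using \<Phi>(2) by auto
  then show ?thesis unfolding howe_kernel_def by blast
qed

text \<open>The stable subspace \<open>F\<close> is kept general: it will be the whole Fock space
  when K-types are lifted, and one parity space when the scalar of -1 is determined.\<close>

lemma irreducible_image:
  assumes \<pi>: "irreducible_gK_module G \<pi>" and T: "T \<in> Hom_gK G fock \<pi>"
    and F: "F \<subseteq> vecs fock" "fock_vs.subspace F"
      "\<And>k p. k \<in> coverK G \<Longrightarrow> p \<in> F \<Longrightarrow> fock_gact k p \<in> F"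
      "\<And>X p. X \<in> complex_Lie G \<Longrightarrow> p \<in> F \<Longrightarrow> fock_lact X p \<in> F"
    and p: "p \<in> F" "T p \<noteq> 0"
  shows "T ` F = vecs \<pi>"
proof -
  have K\<pi>: "K_module (coverK G) \<pi>" using \<pi> by (simp add: irreducible_gK_module_def gK_module_def)
  interpret p: vector_space "scl \<pi>" using K_moduleD[OF K\<pi>] by blast
  have lin: "linear_on fock (scl \<pi>) T" and into: "T ` vecs fock \<subseteq> vecs \<pi>"
    and Tk: "\<And>k q. k \<in> coverK G \<Longrightarrow> q \<in> vecs fock \<Longrightarrow> T (fock_gact k q) = gact \<pi> k (T q)"
    and TX: "\<And>X q. X \<in> complex_Lie G \<Longrightarrow> q \<in> vecs fock \<Longrightarrow> T (fock_lact X q) = lact \<pi> X (T q)"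
    using T by (simp_all add: Hom_gK_def Hom_K_def)
  have add: "T (q + r) = T q + T r" if "q \<in> F" "r \<in> F" for q r
    using lin F(1) that unfolding linear_on_def by blast
  have scale: "T (\<lambda>z. c * q z) = scl \<pi> c (T q)" if "q \<in> F" for c q
    using lin F(1) that by (auto simp: linear_on_def)
  have zero: "T 0 = 0"
    using linear_on_zero[OF lin] subspace_fock fock_vs.vector_space_axioms p.vector_space_axioms by simp
  have "p.subspace (T ` F)"
    unfolding p.subspace_def
  proof (intro conjI ballI allI)
    show "0 \<in> T ` F" using zero fock_vs.subspace_0[OF F(2)] by (metis imageI)
    show "x + y \<in> T ` F" if "x \<in> T ` F" "y \<in> T ` F" for x y
      using that add fock_vs.subspace_add[OF F(2)] by (smt (verit) imageE imageI)
    show "scl \<pi> c x \<in> T ` F" if "x \<in> T ` F" for c x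
      using that scale fock_vs.subspace_scale[OF F(2)] by (smt (verit) imageE imageI)
  qed
  moreover have "T ` F \<subseteq> vecs \<pi>" using into F(1) by blast
  moreover have "gact \<pi> k ` T ` F \<subseteq> T ` F" if "k \<in> coverK G" for k
  proof clarify
    fix q assume "q \<in> F"
    then show "gact \<pi> k (T q) \<in> T ` F"
      using F(1) F(3)[OF that] Tk[OF that] by (metis imageI subsetD)
  qed
  moreover have "lact \<pi> X ` T ` F \<subseteq> T ` F" if "X \<in> complex_Lie G" for X
  proof clarify
    fix q assume "q \<in> F"
    then show "lact \<pi> X (T q) \<in> T ` F"
      using F(1) F(4)[OF that] TX[OF that] by (metis imageI subsetD)
  qed
  moreover have "S = {0} \<or> S = vecs \<pi>"
    if "p.subspace S" "S \<subseteq> vecs \<pi>" "\<And>k. k \<in> coverK G \<Longrightarrow> gact \<pi> k ` S \<subseteq> S"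
      "\<And>X. X \<in> complex_Lie G \<Longrightarrow> lact \<pi> X ` S \<subseteq> S" for S
    using \<pi> that by (simp add: irreducible_gK_module_def)
  ultimately have "T ` F = {0} \<or> T ` F = vecs \<pi>"
    by presburger
  then show ?thesis using p by blast
qed

section \<open>The sign attached to \<pi> and the degrees of its K-types\<close>

text \<open>The scalar comes from surjectivity of \<open>T\<close> on one parity space, without
  Schur's lemma. Its explicit form lets the sign be recovered later by cancelling the power of
  i.\<close>

lemma minus_one_acts_by_scalar:
  fixes \<pi> :: "('n::finite, 'v::ab_group_add) gkmodule"
  assumes \<pi>: "irreducible_gK_module G \<pi>" and T: "T \<in> Hom_gK G fock \<pi>"
    and p: "p \<in> vecs fock" "T p \<noteq> 0" and k: "minus_one_lift \<in> coverK G"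
  shows "\<exists>\<epsilon>. (\<epsilon> = 1 \<or> \<epsilon> = - 1) \<and>
    (\<forall>v\<in>vecs \<pi>. gact \<pi> minus_one_lift v = scl \<pi> (\<epsilon> * inverse (\<i> ^ CARD('n))) v)"
proof -
  have lin: "linear_on fock (scl \<pi>) T"
    and Tk: "\<And>k q. k \<in> coverK G \<Longrightarrow> q \<in> vecs fock \<Longrightarrow> T (fock_gact k q) = gact \<pi> k (T q)"
    using T by (simp_all add: Hom_gK_def Hom_K_def)
  obtain q r where qr: "q \<in> parity_space 1" "r \<in> parity_space (- 1)" "p = q + r"
    using parity_decomposition[OF p(1)] .
  have "T p = T q + T r" using lin qr by (auto simp: linear_on_def parity_space_def)
  then have "T q \<noteq> 0 \<or> T r \<noteq> 0" using p(2) by auto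
  \<comment> \<open>The sign is that of a parity component of \<open>p\<close> which
    \<open>T\<close> does not kill.\<close>
  then obtain \<epsilon> s where \<epsilon>: "\<epsilon> = 1 \<or> \<epsilon> = - 1" and s: "s \<in> parity_space \<epsilon>" "T s \<noteq> 0"
    using qr by blast
  have image: "T ` parity_space \<epsilon> = vecs \<pi>"
  proof (rule irreducible_image[OF \<pi> T _ subspace_parity parity_gact parity_lact s])
    show "parity_space \<epsilon> \<subseteq> vecs fock" unfolding parity_space_def by blast
  qed
  have "gact \<pi> minus_one_lift v = scl \<pi> (\<epsilon> * inverse (\<i> ^ CARD('n))) v" if "v \<in> vecs \<pi>" for v
  proof -
    have "v \<in> T ` parity_space \<epsilon>" using that by (simp only: image)
    then obtain q where q: "v = T q" "q \<in> parity_space \<epsilon>" by (rule imageE)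
    have fock: "q \<in> vecs fock" and par: "q (- z) = \<epsilon> * q z" for z
      using q(2) by (simp_all add: parity_space_def)
    have "gact \<pi> minus_one_lift v = T (fock_gact minus_one_lift q)"
      using Tk[OF k fock] q(1) by simp
    also have "fock_gact minus_one_lift q = scl fock (\<epsilon> * inverse (\<i> ^ CARD('n))) q"
      by (simp add: fock_gact_minus_one par mult_ac)
    also have "T \<dots> = scl \<pi> (\<epsilon> * inverse (\<i> ^ CARD('n))) v"
      using lin fock q(1) unfolding linear_on_def by simp
    finally show ?thesis .
  qed
  with \<epsilon> show ?thesis by blast
qed

text \<open>A non-zero map from the irreducible \<sigma> to \<pi> is injective, so the scalar can be
  pulled back along it.\<close>

lemma Ktype_scalar:
  assumes \<pi>: "K_module K \<pi>" and \<sigma>: "\<sigma> \<in> Ktypes_in K \<pi>" and k: "k \<in> K"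
    and scalar: "\<And>v. v \<in> vecs \<pi> \<Longrightarrow> gact \<pi> k v = scl \<pi> c v"
    and v: "v \<in> vecs \<sigma>"
  shows "gact \<sigma> k v = scl \<sigma> c v"
proof -
  obtain \<tau> v0 where \<tau>: "\<tau> \<in> Hom_K K \<sigma> \<pi>" and v0: "v0 \<in> vecs \<sigma>" "\<tau> v0 \<noteq> 0"
    and type: "is_Ktype K \<sigma>"
    using \<sigma> unfolding Ktypes_in_def by blast
  have \<sigma>K: "K_module K \<sigma>" using type unfolding is_Ktype_def by blast
  interpret s: vector_space "scl \<sigma>" using K_moduleD[OF \<sigma>K] by blast
  interpret p: vector_space "scl \<pi>" using K_moduleD[OF \<pi>] by blast
  note sub = K_moduleD(2)[OF \<sigma>K]
  have lin: "linear_on \<sigma> (scl \<pi>) \<tau>" and into: "\<tau> ` vecs \<sigma> \<subseteq> vecs \<pi>"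
    and \<tau>_k: "\<And>k v. k \<in> K \<Longrightarrow> v \<in> vecs \<sigma> \<Longrightarrow> \<tau> (gact \<sigma> k v) = gact \<pi> k (\<tau> v)"
    using \<tau> by (auto simp: Hom_K_def)
  have zero: "\<tau> 0 = 0"
    using linear_on_zero[OF lin sub] s.vector_space_axioms p.vector_space_axioms by blast
  define S where "S = {v \<in> vecs \<sigma>. \<tau> v = 0}"
  have "s.subspace S"
    using lin zero s.subspace_0[OF sub] s.subspace_add[OF sub] s.subspace_scale[OF sub]
    by (auto simp: s.subspace_def S_def linear_on_def)
  moreover have "gact \<sigma> l ` S \<subseteq> S" if "l \<in> K" for l
  proof -
    have "gact \<pi> l 0 = 0"
      using linear_on_zero[OF K_moduleD(3)[OF \<pi> that]] K_moduleD[OF \<pi>] by blast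
    then show ?thesis using that K_moduleD(4)[OF \<sigma>K that] by (auto simp: S_def \<tau>_k)
  qed
  moreover have "S \<noteq> vecs \<sigma>" using v0 by (auto simp: S_def)
  moreover have "S \<subseteq> vecs \<sigma>" by (auto simp: S_def)
  ultimately have S: "S = {0}" using type unfolding is_Ktype_def by blast
  have mem: "gact \<sigma> k v \<in> vecs \<sigma>" "scl \<sigma> c v \<in> vecs \<sigma>"
    using K_moduleD(4)[OF \<sigma>K k v] s.subspace_scale[OF sub v] by auto
  have "\<tau> (gact \<sigma> k v - scl \<sigma> c v) = \<tau> (gact \<sigma> k v) - \<tau> (scl \<sigma> c v)"
    by (rule linear_on_diff[OF lin sub s.vector_space_axioms p.vector_space_axioms mem])
  also have "\<dots> = 0"
    using into v k lin by (auto simp: \<tau>_k scalar linear_on_def)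
  finally have "gact \<sigma> k v - scl \<sigma> c v \<in> S"
    using s.subspace_diff[OF sub mem] by (simp add: S_def)
  then show ?thesis using S by simp
qed

text \<open>Comparing both descriptions of the action of -1 cancels the power of i and puts the
  image of every equivariant map, hence the isotypic space, into one parity space.\<close>

lemma Ktype_deg_parity:
  fixes \<sigma> :: "('n::finite, 's::ab_group_add) kmodule"
  assumes k: "minus_one_lift \<in> coverK G" and \<sigma>: "\<sigma> \<in> Ktypes_in (coverK G) fock"
    and scalar: "\<And>v. v \<in> vecs \<sigma> \<Longrightarrow> gact \<sigma> minus_one_lift v = scl \<sigma> (\<epsilon> * inverse (\<i> ^ CARD('n))) v"
    and \<epsilon>: "\<epsilon> = 1 \<or> \<epsilon> = - 1"
  shows "(- 1) ^ Ktype_deg G \<sigma> = \<epsilon>"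
proof -
  have "T v \<in> parity_space \<epsilon>" if T: "T \<in> Hom_K (coverK G) \<sigma> fock" and v: "v \<in> vecs \<sigma>" for T v
  proof -
    have "fock_gact minus_one_lift (T v) = T (scl \<sigma> (\<epsilon> * inverse (\<i> ^ CARD('n))) v)"
      using T v k by (simp add: Hom_K_def flip: scalar)
    also have "\<dots> = (\<lambda>z. \<epsilon> * inverse (\<i> ^ CARD('n)) * T v z)"
      using T v by (auto simp: Hom_K_def linear_on_def)
    finally have "T v (- z) = \<epsilon> * T v z" for z
      by (simp add: fock_gact_minus_one fun_eq_iff mult.left_commute)
    then show ?thesis using T v by (auto simp: parity_space_def Hom_K_def)
  qed
  then have iso: "isotypic (coverK G) fock \<sigma> \<subseteq> parity_space \<epsilon>"
    unfolding isotypic_def scl_fock by (intro fock_vs.span_minimal subspace_parity) blast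
  \<comment> \<open>The minimum defining \<open>Ktype_deg\<close> is attained once the isotypic
    space contains a non-zero polynomial, which the occurrence of \<sigma> supplies.\<close>
  obtain T v where T: "T \<in> Hom_K (coverK G) \<sigma> fock" "v \<in> vecs \<sigma>" "T v \<noteq> 0"
    using \<sigma> unfolding Ktypes_in_def by blast
  then have "T v \<in> isotypic (coverK G) fock \<sigma>"
    unfolding isotypic_def scl_fock by (intro fock_vs.span_base) blast
  with T(3) have "\<exists>d. \<exists>p\<in>isotypic (coverK G) fock \<sigma>. p \<noteq> 0 \<and> poly_degree p = d" by blast
  then have "\<exists>p\<in>isotypic (coverK G) fock \<sigma>. p \<noteq> 0 \<and> poly_degree p = Ktype_deg G \<sigma>"
    unfolding Ktype_deg_def by (rule LeastI_ex)
  then obtain p where p: "p \<in> isotypic (coverK G) fock \<sigma>" "p \<noteq> 0" "poly_degree p = Ktype_deg G \<sigma>"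
    by blast
  show ?thesis
    using poly_degree_parity[OF subsetD[OF iso p(1)] p(2) \<epsilon>] p(3) by simp
qed

theorem theorem1p5:
  fixes G G' :: "('n::finite) rmat set"
    and \<pi> :: "('n, 'v::ab_group_add) gkmodule"
    and \<Theta> :: "('n, 'w::ab_group_add) gkmodule"
    and \<theta> :: "('n, 'u::ab_group_add) gkmodule"
    and \<sigma>1 :: "('n, 's::ab_group_add) kmodule"
    and \<sigma>2 :: "('n, 't::ab_group_add) kmodule"
  assumes "reductive_dual_pair G G'"
    and "maximal_compact_in (maxU \<inter> G) G"
    and "maximal_compact_in (maxU \<inter> G') G'"
    and "irreducible_gK_module G \<pi>"
    and "is_theta_lift G G' \<pi> \<Theta> \<theta>"
    and "vecs \<theta> \<noteq> {0}"
    and "\<sigma>1 \<in> Ktypes_in (coverK G) \<pi>"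
    and "\<sigma>2 \<in> Ktypes_in (coverK G) \<pi>"
  shows "\<sigma>1 \<in> Ktypes_in (coverK G) fock \<and> \<sigma>2 \<in> Ktypes_in (coverK G) fock \<and>
         Ktype_deg G \<sigma>1 mod 2 = Ktype_deg G \<sigma>2 mod 2"
proof -
  note \<pi> = assms(4) and \<sigma>1 = assms(7) and \<sigma>2 = assms(8)
  have K: "K_module (coverK G) \<pi>" using \<pi> by (simp add: irreducible_gK_module_def gK_module_def)
  have k: "minus_one_lift \<in> coverK G"
    using assms(1) minus_one_lift_in_coverK unfolding reductive_dual_pair_def by blast
  obtain T p where T: "T \<in> Hom_gK G fock \<pi>" and p: "p \<in> vecs fock" "T p \<noteq> 0"
    using theta_lift_hom[OF \<pi> assms(5,6)] by blast
  \<comment> \<open>The sign is fixed by \<pi> before any K-type is considered, so both K-types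
    inherit the same one.\<close>
  obtain \<epsilon> where \<epsilon>: "\<epsilon> = 1 \<or> \<epsilon> = - 1"
    and scalar: "\<And>v. v \<in> vecs \<pi> \<Longrightarrow> gact \<pi> minus_one_lift v = scl \<pi> (\<epsilon> * inverse (\<i> ^ CARD('n))) v"
    using minus_one_acts_by_scalar[OF \<pi> T p k] by blast
  have image: "T ` vecs fock = vecs \<pi>"
    by (rule irreducible_image[OF \<pi> T subset_refl subspace_fock fock_gact_in_fock fock_lact_in_fock p])
  have hom: "T \<in> Hom_K (coverK G) fock \<pi>" using T by (simp add: Hom_gK_def)
  have maxU: "fst k \<in> maxU" if "k \<in> coverK G" for k
    using that by (auto simp: coverK_def cover_def)
  have F1: "\<sigma>1 \<in> Ktypes_in (coverK G) fock"
    by (rule Ktype_lifts_to_fock[OF K maxU hom image \<sigma>1])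
  have F2: "\<sigma>2 \<in> Ktypes_in (coverK G) fock"
    by (rule Ktype_lifts_to_fock[OF K maxU hom image \<sigma>2])
  have "(- 1) ^ Ktype_deg G \<sigma>1 = \<epsilon>"
    by (rule Ktype_deg_parity[OF k F1 Ktype_scalar[OF K \<sigma>1 k scalar] \<epsilon>])
  moreover have "(- 1) ^ Ktype_deg G \<sigma>2 = \<epsilon>"
    by (rule Ktype_deg_parity[OF k F2 Ktype_scalar[OF K \<sigma>2 k scalar] \<epsilon>])
  ultimately have "(- 1 :: complex) ^ Ktype_deg G \<sigma>1 = (- 1) ^ Ktype_deg G \<sigma>2" by simp
  then have "even (Ktype_deg G \<sigma>1) = even (Ktype_deg G \<sigma>2)"
    by (cases "even (Ktype_deg G \<sigma>1)"; cases "even (Ktype_deg G \<sigma>2)") auto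
  then show ?thesis using F1 F2 by (simp add: mod2_eq_if)
qed

end
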